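(* Fix integers $n,L,M,K\ge 1$, a power $P>0$, and a (deterministic, unknown to the receiver) number $K_a\in[0:K]$ of active users. For a parameter $0<P'\le P$, consider the following scheme. A random codebook $\mathbf C=[\mathbf c_1,\dots,\mathbf c_M]\in\mathbb C^{n\times M}$ is drawn either (G) with columns i.i.d. $\mathcal{CN}(\mathbf 0,P'\mathbf I_n)$, or (S) with columns drawn i.i.d. uniformly from the sphere of radius $\sqrt{nP'}=\sqrt{nP}$ in $\mathbb C^n$ (so $P'=P$ in case (S)). Each active user $k$ picks its message $W_k$ uniformly from $[M]$, independently, and transmits $\mathbf x_{W_k}=\mathbf c_{W_k}\,1\{\|\mathbf c_{W_k}\|_2^2\le nP\}$. The receiver, with $L$ antennas, observes $\mathbf Y=[\mathbf y_1,\dots,\mathbf y_L]$, $\mathbf y_l=\sum_{k\in\mathcal K_a}h_{k,l}\mathbf x_{W_k}+\mathbf z_l$, where $h_{k,l}$ are i.i.d. $\mathcal{CN}(0,1)$ and $\mathbf z_l$ are i.i.d. $\mathcal{CN}(\mathbf 0,\mathbf I_n)$, all independent and unknown to the receiver. The receiver estimates the number of active users as $$K'_a\in\arg\min_{\tilde K_a\in[0:K]}\Big|\|\mathbf Y\|_F^2-nL(1+\tilde K_aP')\Big|.$$ Then for every $K'_a\ne K_a$, the probability $\mathbb P[K_a\to K'_a]$ that $K_a$ is estimated as $K'_a$ satisfies $$\mathbb P[K_a\to K'_a]\le \min_{0<P'\le P}\big\{p_{K_a\to K'_a,\mathrm{new}}+p_{0,K_a}\big\},$$ (where the left-hand side refers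 to the scheme with the minimizing parameter $P'$), with $$p_{K_a\to K'_a,\mathrm{new}}=\min_{\tilde K_a\in[0:K],\ \tilde K_a\ne K'_a}\Big\{1[K'_a<\tilde K_a]\,p_{K'_a,1}+1[K'_a>\tilde K_a]\,p_{K'_a,2}\Big\},$$ $$p_{K'_a,1}=\mathbb E\Big[\min_{\rho\ge0}\exp\Big\{\rho nL(1+\tilde K'_aP')-L\ln|\mathbf I_n+\rho\mathbf F|\Big\}\Big],$$ $$p_{K'_a,2}=\mathbb E\Big[\min_{0\le\rho<1/(1+\lambda'_1)}\exp\Big\{-\rho nL(1+\tilde K'_aP')-L\ln|\mathbf I_n-\rho\mathbf F|\Big\}\Big],$$ where $\tilde K'_a=(K'_a+\tilde K_a)/2$, $\mathbf F=\mathbf I_n+\mathbf C\boldsymbol\Lambda_{\mathcal K_a}\mathbf C^H$, $\lambda'_1$ is the largest eigenvalue of $\mathbf C\boldsymbol\Lambda_{\mathcal K_a}\mathbf C^H$, and $p_{0,K_a}=K_a\Gamma(n,nP/P')/\Gamma(n)$ in case (G) and $p_{0,K_a}=0$ in case (S).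
   Context: $[k_1:k_2]=\{k_1,\dots,k_2\}$, $[k]=\{1,\dots,k\}$. $\mathcal K_a$ is the set of active users, $|\mathcal K_a|=K_a$. $\boldsymbol\Lambda_{\mathcal K_a}\in\mathbb N^{M\times M}$ is the diagonal matrix whose $(m,m)$ entry is the number of active users that selected message $m$. Expectations are over the random codebook $\mathbf C$ and the messages of the active users. $\Gamma(a,x)=\int_x^\infty t^{a-1}e^{-t}dt$ is the upper incomplete gamma function and $\Gamma(\cdot)$ the gamma function. $|\cdot|$ denotes determinant and $\|\cdot\|_F$ the Frobenius norm. *)

theory Defs
  imports "HOL-Probability.Probability" "Jordan_Normal_Form.Char_Poly" "Jordan_Normal_Form.Determinant"
begin

definition cgauss :: "real \<Rightarrow> complex measure" where
  "cgauss v = distr (density lborel (normal_density 0 (sqrt (v/2)))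
                      \<Otimes>\<^sub>M density lborel (normal_density 0 (sqrt (v/2))))
                 borel (\<lambda>(a,b). Complex a b)"

(* vectors in C^n are functions on {..<n};  squared Euclidean norm *)
definition vsqnorm :: "nat \<Rightarrow> (nat \<Rightarrow> complex) \<Rightarrow> real" where
  "vsqnorm n x = (\<Sum>i<n. (cmod (x i))\<^sup>2)"

abbreviation lebC :: "nat \<Rightarrow> (nat \<Rightarrow> complex) measure" where
  "lebC n \<equiv> PiM {..<n} (\<lambda>_. lborel)"

(* Uniform distribution on the sphere of radius r in C^n: the normalized (cone = surface)
   measure, i.e. radial projection of the uniform distribution on the unit ball. *)
definition sphere_unif :: "nat \<Rightarrow> real \<Rightarrow> (nat \<Rightarrow> complex) measure" where
  "sphere_unif n r =
     distr (uniform_measure (lebC n) {x \<in> space (lebC n). vsqnorm n x \<le> 1})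
           (PiM {..<n} (\<lambda>_. borel))
           (\<lambda>x. restrict (\<lambda>i. complex_of_real (r / sqrt (vsqnorm n x)) * x i) {..<n})"

definition col_dist :: "bool \<Rightarrow> nat \<Rightarrow> real \<Rightarrow> real \<Rightarrow> (nat \<Rightarrow> complex) measure" where
  "col_dist sph n P P' = (if sph then sphere_unif n (sqrt (real n * P))
                          else PiM {..<n} (\<lambda>_. cgauss P'))"

(* codebook: cb m = column m (m < M), cb m i = entry i (i < n) *)
definition codebook_measure :: "bool \<Rightarrow> nat \<Rightarrow> nat \<Rightarrow> real \<Rightarrow> real \<Rightarrow> (nat \<Rightarrow> nat \<Rightarrow> complex) measure" where
  "codebook_measure sph n M P P' = PiM {..<M} (\<lambda>_. col_dist sph n P P')"

definition msg_measure :: "nat \<Rightarrow> nat \<Rightarrow> (nat \<Rightarrow> nat) measure" where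
  "msg_measure Ka M = PiM {..<Ka} (\<lambda>_. measure_pmf (pmf_of_set {..<M}))"

definition fading_measure :: "nat \<Rightarrow> nat \<Rightarrow> (nat \<Rightarrow> nat \<Rightarrow> complex) measure" where
  "fading_measure Ka L = PiM {..<Ka} (\<lambda>_. PiM {..<L} (\<lambda>_. cgauss 1))"

definition noise_measure :: "nat \<Rightarrow> nat \<Rightarrow> (nat \<Rightarrow> nat \<Rightarrow> complex) measure" where
  "noise_measure n L = PiM {..<L} (\<lambda>_. PiM {..<n} (\<lambda>_. cgauss 1))"

definition scheme_space where
  "scheme_space sph n L M P P' Ka =
     codebook_measure sph n M P P' \<Otimes>\<^sub>M msg_measure Ka M \<Otimes>\<^sub>M
     fading_measure Ka L \<Otimes>\<^sub>M noise_measure n L"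

definition xmit :: "nat \<Rightarrow> real \<Rightarrow> (nat \<Rightarrow> nat \<Rightarrow> complex) \<Rightarrow> nat \<Rightarrow> nat \<Rightarrow> complex" where
  "xmit n P cb m i = (if vsqnorm n (cb m) \<le> real n * P then cb m i else 0)"

definition rx :: "nat \<Rightarrow> real \<Rightarrow> nat \<Rightarrow> (nat \<Rightarrow> nat \<Rightarrow> complex) \<Rightarrow> (nat \<Rightarrow> nat)
                   \<Rightarrow> (nat \<Rightarrow> nat \<Rightarrow> complex) \<Rightarrow> (nat \<Rightarrow> nat \<Rightarrow> complex) \<Rightarrow> nat \<Rightarrow> nat \<Rightarrow> complex" where
  "rx n P Ka cb w h z l i = (\<Sum>k<Ka. h k l * xmit n P cb (w k) i) + z l i"

definition frob2 :: "nat \<Rightarrow> nat \<Rightarrow> (nat \<Rightarrow> nat \<Rightarrow> complex) \<Rightarrow> real" where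
  "frob2 n L Y = (\<Sum>l<L. \<Sum>i<n. (cmod (Y l i))\<^sup>2)"

definition is_est :: "nat \<Rightarrow> nat \<Rightarrow> nat \<Rightarrow> real \<Rightarrow> real \<Rightarrow> nat \<Rightarrow> bool" where
  "is_est n L K P' y Kest \<longleftrightarrow> Kest \<le> K \<and>
     (\<forall>Kt\<le>K. \<bar>y - real n * real L * (1 + real Kest * P')\<bar>
               \<le> \<bar>y - real n * real L * (1 + real Kt * P')\<bar>)"

definition est_event where
  "est_event sph n L M K P P' Ka Kest =
     {(cb, w, h, z) \<in> space (scheme_space sph n L M P P' Ka).
        is_est n L K P' (frob2 n L (rx n P Ka cb w h z)) Kest}"

(* C Lambda_{K_a} C^H, with Lambda(m,m) = number of active users choosing m *)
definition gram :: "nat \<Rightarrow> nat \<Rightarrow> nat \<Rightarrow> (nat \<Rightarrow> nat \<Rightarrow> complex) \<Rightarrow> (nat \<Rightarrow> nat) \<Rightarrow> complex mat" where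
  "gram n M Ka cb w = mat n n (\<lambda>(i,j).
      \<Sum>m<M. of_nat (card {k. k < Ka \<and> w k = m}) * cb m i * cnj (cb m j))"

definition Fmat where "Fmat n M Ka cb w = 1\<^sub>m n + gram n M Ka cb w"

(* largest eigenvalue lambda'_1 of C Lambda C^H (Hermitian, so its eigenvalues are real) *)
definition lam1 where
  "lam1 n M Ka cb w = Max {e::real. eigenvalue (gram n M Ka cb w) (complex_of_real e)}"

definition p1_integrand where
  "p1_integrand n L M Ka P' Kth cb w =
     (INF \<rho>\<in>{0::real..}. exp (\<rho> * real n * real L * (1 + Kth * P')
        - real L * ln (Re (det (1\<^sub>m n + complex_of_real \<rho> \<cdot>\<^sub>m Fmat n M Ka cb w)))))"

definition p2_integrand where
  "p2_integrand n L M Ka P' Kth cb w =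
     (INF \<rho>\<in>{0::real..<1 / (1 + lam1 n M Ka cb w)}. exp (- \<rho> * real n * real L * (1 + Kth * P')
        - real L * ln (Re (det (1\<^sub>m n - complex_of_real \<rho> \<cdot>\<^sub>m Fmat n M Ka cb w)))))"

definition p1 where
  "p1 sph n L M Ka P P' Kth =
     (\<integral>\<^sup>+ (cb, w). ennreal (p1_integrand n L M Ka P' Kth cb w)
        \<partial>(codebook_measure sph n M P P' \<Otimes>\<^sub>M msg_measure Ka M))"

definition p2 where
  "p2 sph n L M Ka P P' Kth =
     (\<integral>\<^sup>+ (cb, w). ennreal (p2_integrand n L M Ka P' Kth cb w)
        \<partial>(codebook_measure sph n M P P' \<Otimes>\<^sub>M msg_measure Ka M))"

definition p_new where
  "p_new sph n L M K Ka P P' Kest =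
     Min ((\<lambda>Kt. (if Kest < Kt then p1 sph n L M Ka P P' ((real Kest + real Kt) / 2) else 0)
              + (if Kest > Kt then p2 sph n L M Ka P P' ((real Kest + real Kt) / 2) else 0))
          ` ({0..K} - {Kest}))"

definition upper_gamma :: "real \<Rightarrow> real \<Rightarrow> real" where
  "upper_gamma a x = (LINT t:{x..}|lborel. t powr (a - 1) * exp (- t))"

definition p0 where
  "p0 sph n Ka P P' = (if sph then 0
      else real Ka * upper_gamma (real n) (real n * P / P') / Gamma (real n))"

end

theory Submission
  imports Defs
begin

text \<open>
  Estimating \<open>K'\<close> forces \<open>\<parallel>Y\<parallel>\<^sup>2\<close> to lie on the \<open>K'\<close>-side of the midpoint
  \<open>nL(1 + (K' + K~)P'/2)\<close> for every competitor \<open>K~\<close>. Unless some active codeword violates the power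
  constraint (a union bound, with the tail of an Erlang variable, gives \<open>p0\<close>), the channel output given
  codebook and messages is \<open>L\<close> independent complex Gaussian vectors with covariance \<open>F\<close>, so the Chernoff
  bound applies with moment generating function \<open>det (1 - s F)\<^sup>-\<^sup>L\<close>.

  That generating function is obtained by integrating the noise, which leaves a Gaussian integral
  over the fading coefficients with quadratic form \<open>1 - t X\<^sup>H X\<close>, \<open>t = s / (1 - s)\<close>. It is evaluated one
  user at a time, each step replacing the form by a Schur complement; \<open>det (1 - t X\<^sup>H X) = det (1 - t X X\<^sup>H)\<close>
  returns to \<open>F\<close>. Positive definiteness for \<open>s < 1 / (1 + lam1)\<close> holds because the maximum of the
  Rayleigh quotient is an eigenvalue.
\<close>

section \<open>Gaussian integrals with a quadratic exponent\<close>

text \<open>The order of integration shapes the proof. Given codebook, messages and fading, the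
  received entries are independent, so the noise costs only scalar integrals and \<open>F\<close> is
  never diagonalised. What remains has one dimension per user, and induction over users works
  because positive definiteness passes to the Schur complement. Forms and vectors are functions on
  the naturals, where dropping the last index is free; \<open>mat\<close> appears only where
  determinants and eigenvalues do.

  One computation serves both tails, with s = -\<rho> for the lower and s = \<rho> for the upper
  one. For s \<le> 0 also t \<le> 0 and the form is positive definite outright; for 0 < s < 1 the
  condition t * lam1 < 1 amounts to s * (1 + lam1) < 1, the range of \<rho> in
  \<open>p2_integrand\<close>.

  Since \<rho> is optimised inside the expectation, the Chernoff bound is proved for each fixed
  codebook and message choice. Truncation needs no change of measure: where no active codeword
  violates the constraint, \<open>rx\<close> agrees with the untruncated channel, and elsewhere the
  conditional probability is bounded by 1.\<close>

lemma prob_space_real_gauss: "v > 0 \<Longrightarrow> prob_space (density lborel (normal_density 0 (sqrt (v/2))))"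
  by (rule prob_space_normal_density) simp

lemma sets_cgauss [simp, measurable_cong]: "sets (cgauss v) = sets borel"
  by (simp add: cgauss_def)

lemma space_cgauss [simp]: "space (cgauss v) = UNIV"
  by (simp add: cgauss_def)

lemma measurable_Complex [measurable]:
  "(\<lambda>(a,b). Complex a b) \<in> borel_measurable (borel \<Otimes>\<^sub>M borel)"
  unfolding Complex_eq by measurable

lemma nn_integral_cgauss:
  assumes "v > 0" and [measurable]: "f \<in> borel_measurable borel"
  shows "(\<integral>\<^sup>+z. f z \<partial>cgauss v) =
    (\<integral>\<^sup>+x. (\<integral>\<^sup>+y. f (Complex x y) \<partial>density lborel (normal_density 0 (sqrt (v/2))))
      \<partial>density lborel (normal_density 0 (sqrt (v/2))))"
proof -
  let ?D = "density lborel (normal_density 0 (sqrt (v/2)))"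
  interpret D: prob_space ?D by (rule prob_space_real_gauss) fact
  interpret DD: pair_sigma_finite ?D ?D ..
  have "(\<integral>\<^sup>+z. f z \<partial>cgauss v) = (\<integral>\<^sup>+p. f (case p of (a,b) \<Rightarrow> Complex a b) \<partial>(?D \<Otimes>\<^sub>M ?D))"
    unfolding cgauss_def by (rule nn_integral_distr) simp_all
  also have "\<dots> = (\<integral>\<^sup>+x. (\<integral>\<^sup>+y. f (Complex x y) \<partial>?D) \<partial>?D)"
    by (subst D.nn_integral_fst[symmetric]) simp_all
  finally show ?thesis .
qed

lemma prob_space_cgauss:
  assumes "v > 0" shows "prob_space (cgauss v)"
proof -
  let ?D = "density lborel (normal_density 0 (sqrt (v/2)))"
  interpret D: prob_space ?D by (rule prob_space_real_gauss) fact
  interpret DD: pair_prob_space ?D ?D ..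
  show ?thesis unfolding cgauss_def by (rule DD.prob_space_distr) simp
qed

text \<open>Completing the square: with variance 1/2 the weight is proportional to exp(-x^2), so
  weight times integrand is a constant times the normal density with mean b / (1 - a) and variance 1
  / (2 (1 - a)), positive since \<open>a < 1\<close>.\<close>

lemma nn_integral_real_gauss_quadratic:
  assumes "a < 1"
  shows "(\<integral>\<^sup>+x. ennreal (exp (a * x\<^sup>2 + 2 * b * x)) \<partial>density lborel (normal_density 0 (sqrt (1/2)))) =
    ennreal (exp (b\<^sup>2 / (1 - a)) / sqrt (1 - a))"
proof -
  define c where "c = 1 - a"
  have c: "c > 0" using assms by (simp add: c_def)
  define K where "K = exp (b\<^sup>2 / c) / sqrt c"
  have K: "K \<ge> 0" using c by (simp add: K_def)
  let ?N = "normal_density (b / c) (sqrt (1 / (2 * c)))"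
  have eq: "normal_density 0 (sqrt (1/2)) x * exp (a * x\<^sup>2 + 2 * b * x) = K * ?N x" for x
  proof -
    have "b\<^sup>2 / c - (x - b / c)\<^sup>2 / (2 * (1 / (2 * c))) = - (x\<^sup>2) / (2 * (1/2)) + (a * x\<^sup>2 + 2 * b * x)"
    proof -
      have a: "a = 1 - c" by (simp add: c_def)
      show ?thesis using c by (simp add: a field_simps power2_eq_square)
    qed
    then have "exp (b\<^sup>2 / c) * exp (- (x - b / c)\<^sup>2 / (2 * (1 / (2 * c)))) =
        exp (- (x\<^sup>2) / (2 * (1/2))) * exp (a * x\<^sup>2 + 2 * b * x)"
      by (simp add: mult_exp_exp)
    then show ?thesis
      using c by (simp add: normal_density_def K_def real_sqrt_divide real_sqrt_mult field_simps)
  qed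
  have "(\<integral>\<^sup>+x. ennreal (exp (a * x\<^sup>2 + 2 * b * x)) \<partial>density lborel (normal_density 0 (sqrt (1/2)))) =
      (\<integral>\<^sup>+x. ennreal (normal_density 0 (sqrt (1/2)) x) * ennreal (exp (a * x\<^sup>2 + 2 * b * x)) \<partial>lborel)"
    by (rule nn_integral_density) simp_all
  also have "\<dots> = (\<integral>\<^sup>+x. ennreal K * ennreal (?N x) \<partial>lborel)"
    using K by (simp add: ennreal_mult'[symmetric] eq)
  also have "\<dots> = ennreal K * (\<integral>\<^sup>+x. ennreal (?N x) \<partial>lborel)"
    by (rule nn_integral_cmult) simp
  also have "(\<integral>\<^sup>+x. ennreal (?N x) \<partial>lborel) = 1"
  proof -
    interpret prob_space "density lborel ?N"
      by (rule prob_space_normal_density) (use c in simp)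
    show ?thesis using emeasure_space_1 by (simp add: emeasure_density)
  qed
  finally show ?thesis by (simp add: K_def c_def)
qed

text \<open>The exponent splits into real and imaginary parts, each contributing 1 / sqrt (1 - a).
  The two roots multiply up, which is why determinants later occur to an integral power.\<close>

lemma nn_integral_cgauss_quadratic:
  assumes "a < 1"
  shows "(\<integral>\<^sup>+z. ennreal (exp (a * (cmod z)\<^sup>2 + 2 * Re (b * z))) \<partial>cgauss 1) =
    ennreal (exp ((cmod b)\<^sup>2 / (1 - a)) / (1 - a))"
proof -
  let ?D = "density lborel (normal_density 0 (sqrt (1/2)))"
  have *: "ennreal (exp (a * (cmod (Complex x y))\<^sup>2 + 2 * Re (b * Complex x y))) =
     ennreal (exp (a * x\<^sup>2 + 2 * Re b * x)) * ennreal (exp (a * y\<^sup>2 + 2 * (- Im b) * y))" for x y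
    by (simp add: ennreal_mult'[symmetric] mult_exp_exp cmod_power2 algebra_simps)
  have "(\<integral>\<^sup>+z. ennreal (exp (a * (cmod z)\<^sup>2 + 2 * Re (b * z))) \<partial>cgauss 1) =
      (\<integral>\<^sup>+x. (\<integral>\<^sup>+y. ennreal (exp (a * x\<^sup>2 + 2 * Re b * x)) * ennreal (exp (a * y\<^sup>2 + 2 * (- Im b) * y)) \<partial>?D) \<partial>?D)"
    by (subst nn_integral_cgauss) (simp_all only: *, simp_all)
  also have "\<dots> = (\<integral>\<^sup>+x. ennreal (exp (a * x\<^sup>2 + 2 * Re b * x)) * (\<integral>\<^sup>+y. ennreal (exp (a * y\<^sup>2 + 2 * (- Im b) * y)) \<partial>?D) \<partial>?D)"
    by (intro nn_integral_cong nn_integral_cmult) simp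
  also have "\<dots> = (\<integral>\<^sup>+x. ennreal (exp (a * x\<^sup>2 + 2 * Re b * x)) \<partial>?D) * (\<integral>\<^sup>+y. ennreal (exp (a * y\<^sup>2 + 2 * (- Im b) * y)) \<partial>?D)"
    by (rule nn_integral_multc) simp
  also have "\<dots> = ennreal (exp ((Re b)\<^sup>2 / (1 - a)) / sqrt (1 - a)) * ennreal (exp ((- Im b)\<^sup>2 / (1 - a)) / sqrt (1 - a))"
    by (simp only: nn_integral_real_gauss_quadratic[OF assms])
  also have "\<dots> = ennreal (exp ((cmod b)\<^sup>2 / (1 - a)) / (1 - a))"
    using assms by (simp add: ennreal_mult'[symmetric] cmod_power2 add_divide_distrib exp_add)
  finally show ?thesis .
qed

section \<open>Schur complements\<close>

text \<open>Right multiplication by a unitriangular block matrix clears the lower left corner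
  without changing the determinant. Taking \<open>E\<close> as a solution of
  \<open>C + D * E = 0\<close> avoids inverting \<open>D\<close>, so the identity holds over any
  integral domain.\<close>

lemma det_four_block_mat_eliminate_lower_left:
  fixes A :: "'a :: idom mat"
  assumes A: "A \<in> carrier_mat n n" and B: "B \<in> carrier_mat n m" and C: "C \<in> carrier_mat m n"
    and D: "D \<in> carrier_mat m m" and E: "E \<in> carrier_mat m n" and elim: "C + D * E = 0\<^sub>m m n"
  shows "det (four_block_mat A B C D) = det (A + B * E) * det D"
proof -
  let ?M = "four_block_mat A B C D"
  let ?L = "four_block_mat (1\<^sub>m n) (0\<^sub>m n m) E (1\<^sub>m m)"
  have "?M * ?L = four_block_mat (A * 1\<^sub>m n + B * E) (A * 0\<^sub>m n m + B * 1\<^sub>m m)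
      (C * 1\<^sub>m n + D * E) (C * 0\<^sub>m n m + D * 1\<^sub>m m)"
    by (rule mult_four_block_mat) (use assms in auto)
  also have "\<dots> = four_block_mat (A + B * E) B (0\<^sub>m m n) D"
    using assms by simp
  finally have "det (?M * ?L) = det (A + B * E) * det D"
    using assms by (simp add: det_four_block_mat_lower_left_zero[of _ n _ m])
  moreover have "det (?M * ?L) = det ?M * det ?L"
    by (rule det_mult[of _ "n + m"]) (use assms in auto)
  moreover have "det ?L = 1"
    using E by (subst det_four_block_mat_upper_right_zero[of _ n _ m]) auto
  ultimately show ?thesis by simp
qed

text \<open>Sylvester's identity. Both sides are the determinant of \<open>?M\<close>: one by column
  elimination, the other by row elimination with the same factor \<open>?L\<close>.\<close>

lemma det_one_minus_mult_commute:
  fixes B :: "'a :: idom mat"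
  assumes B: "B \<in> carrier_mat n m" and C: "C \<in> carrier_mat m n"
  shows "det (1\<^sub>m n - B * C) = det (1\<^sub>m m - C * B)"
proof -
  let ?M = "four_block_mat (1\<^sub>m n) B C (1\<^sub>m m)"
  let ?L = "four_block_mat (1\<^sub>m n) (0\<^sub>m n m) (- C) (1\<^sub>m m)"
  have BC: "B * C \<in> carrier_mat n n" and CB: "C * B \<in> carrier_mat m m"
    using B C by auto
  have "det ?M = det (1\<^sub>m n + B * (- C)) * det (1\<^sub>m m :: 'a mat)"
    by (rule det_four_block_mat_eliminate_lower_left) (use B C in auto)
  also have "1\<^sub>m n + B * (- C) = 1\<^sub>m n - B * C"
    using B C BC by (intro eq_matI) auto
  finally have 1: "det ?M = det (1\<^sub>m n - B * C)" by simp
  have "?L * ?M = four_block_mat (1\<^sub>m n * 1\<^sub>m n + 0\<^sub>m n m * C) (1\<^sub>m n * B + 0\<^sub>m n m * 1\<^sub>m m)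
      (- C * 1\<^sub>m n + 1\<^sub>m m * C) (- C * B + 1\<^sub>m m * 1\<^sub>m m)"
    by (rule mult_four_block_mat) (use assms in auto)
  also have "1\<^sub>m n * 1\<^sub>m n + 0\<^sub>m n m * C = 1\<^sub>m n" using C by simp
  also have "1\<^sub>m n * B + 0\<^sub>m n m * 1\<^sub>m m = B" using B by simp
  also have "- C * 1\<^sub>m n + 1\<^sub>m m * C = 0\<^sub>m m n" using C by (intro eq_matI) auto
  also have "- C * B + 1\<^sub>m m * 1\<^sub>m m = 1\<^sub>m m - C * B" using B C CB by (intro eq_matI) auto
  finally have "det (?L * ?M) = det (1\<^sub>m m - C * B)"
    using B C CB by (simp add: det_four_block_mat_lower_left_zero[of _ n _ m "0\<^sub>m m n"] minus_carrier_mat)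
  moreover have "det (?L * ?M) = det ?L * det ?M"
    by (rule det_mult[of _ "n + m"]) (use assms in auto)
  moreover have "det ?L = 1"
    using C by (subst det_four_block_mat_upper_right_zero[of _ n _ m]) auto
  ultimately show ?thesis using 1 by simp
qed

lemma det_mat_Suc_schur:
  fixes B :: "nat \<Rightarrow> nat \<Rightarrow> 'a :: field"
  assumes "B N N \<noteq> 0"
  shows "det (mat (Suc N) (Suc N) (\<lambda>(i,j). B i j)) =
    B N N * det (mat N N (\<lambda>(i,j). B i j - B i N * B N j / B N N))"
proof -
  let ?A = "mat N N (\<lambda>(i,j). B i j)" and ?b = "mat N 1 (\<lambda>(i,j). B i N)"
  let ?c = "mat 1 N (\<lambda>(i,j). B N j)" and ?d = "mat 1 1 (\<lambda>(i,j). B N N)"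
  let ?E = "mat 1 N (\<lambda>(i,j). - B N j / B N N)"
  have "mat (Suc N) (Suc N) (\<lambda>(i,j). B i j) = four_block_mat ?A ?b ?c ?d"
    by (intro eq_matI) (auto simp: less_Suc_eq)
  also have "det \<dots> = det (?A + ?b * ?E) * det ?d"
    by (rule det_four_block_mat_eliminate_lower_left)
      (use assms in \<open>auto intro!: eq_matI simp: scalar_prod_def\<close>)
  also have "?A + ?b * ?E = mat N N (\<lambda>(i,j). B i j - B i N * B N j / B N N)"
    by (intro eq_matI) (auto simp: scalar_prod_def)
  also have "det ?d = B N N"
    by (subst det_single) auto
  finally show ?thesis by simp
qed

section \<open>Hermitian forms and their positive definiteness\<close>

definition hform :: "nat \<Rightarrow> (nat \<Rightarrow> nat \<Rightarrow> complex) \<Rightarrow> (nat \<Rightarrow> complex) \<Rightarrow> complex" where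
  "hform N B v = (\<Sum>k<N. \<Sum>j<N. cnj (v k) * B k j * v j)"

definition herm :: "nat \<Rightarrow> (nat \<Rightarrow> nat \<Rightarrow> complex) \<Rightarrow> bool" where
  "herm N B \<longleftrightarrow> (\<forall>k<N. \<forall>j<N. B j k = cnj (B k j))"

definition pos_def :: "nat \<Rightarrow> (nat \<Rightarrow> nat \<Rightarrow> complex) \<Rightarrow> bool" where
  "pos_def N B \<longleftrightarrow> herm N B \<and> (\<forall>v. (\<exists>k<N. v k \<noteq> 0) \<longrightarrow> 0 < Re (hform N B v))"

lemma hermD: "herm N B \<Longrightarrow> k < N \<Longrightarrow> j < N \<Longrightarrow> B j k = cnj (B k j)"
  unfolding herm_def by blast

lemma hform_cong: "(\<And>k. k < N \<Longrightarrow> v k = w k) \<Longrightarrow> hform N B v = hform N B w"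
  unfolding hform_def by (intro sum.cong refl) auto

lemma Re_hform_Suc:
  assumes "herm (Suc N) B"
  shows "Re (hform (Suc N) B v) = Re (hform N B v)
    + 2 * Re ((\<Sum>k<N. cnj (v k) * B k N) * v N) + Re (B N N) * (cmod (v N))\<^sup>2"
proof -
  define b where "b = (\<Sum>k<N. cnj (v k) * B k N)"
  have herm: "B N j = cnj (B j N)" if "j \<le> N" for j
    by (rule hermD[OF assms]) (use that in auto)
  have b': "(\<Sum>j<N. B N j * v j) = cnj b"
    unfolding b_def cnj_sum by (intro sum.cong refl) (simp add: herm mult.commute)
  have "hform (Suc N) B v = hform N B v + b * v N + cnj (v N) * cnj b + cnj (v N) * B N N * v N"
    unfolding hform_def b'[symmetric]
    by (simp add: sum.distrib b_def sum_distrib_right sum_distrib_left mult.assoc)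
  moreover have "Re (cnj (v N) * B N N * v N) = Re (B N N) * (cmod (v N))\<^sup>2"
    unfolding cmod_power2 by (simp add: power2_eq_square algebra_simps)
  moreover have "Re (cnj (v N) * cnj b) = Re (b * v N)"
    by simp
  ultimately show ?thesis by (simp add: b_def)
qed

text \<open>The rank-one correction factors into two conjugate sums. What it subtracts is exactly
  what completing the square in the last coordinate leaves behind.\<close>

lemma hform_schur:
  assumes "herm (Suc N) B"
  shows "hform N (\<lambda>k j. B k j - B k N * B N j / B N N) v =
    hform N B v - of_real ((cmod (\<Sum>k<N. cnj (v k) * B k N))\<^sup>2) / B N N"
proof -
  define b where "b = (\<Sum>k<N. cnj (v k) * B k N)"
  have herm: "B N j = cnj (B j N)" if "j \<le> N" for j
    by (rule hermD[OF assms]) (use that in auto)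
  have b': "(\<Sum>j<N. B N j * v j) = cnj b"
    unfolding b_def cnj_sum by (intro sum.cong refl) (simp add: herm mult.commute)
  have "hform N (\<lambda>k j. B k j - B k N * B N j / B N N) v =
      hform N B v - (\<Sum>k<N. \<Sum>j<N. (cnj (v k) * B k N) * (B N j * v j)) / B N N"
    unfolding hform_def sum_divide_distrib sum_subtractf[symmetric]
    by (intro sum.cong refl) (simp only: right_diff_distrib left_diff_distrib times_divide_eq_left times_divide_eq_right mult.assoc)
  also have "(\<Sum>k<N. \<Sum>j<N. (cnj (v k) * B k N) * (B N j * v j)) = b * cnj b"
    by (simp add: sum_product[symmetric] b' b_def)
  also have "b * cnj b = of_real ((cmod b)\<^sup>2)"
    by (rule complex_norm_square[symmetric])
  finally show ?thesis by (simp add: b_def)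
qed

text \<open>The pivot is the value of the form at the last basis vector. The Schur form at v is the
  value of the full form at the extension of v whose last coordinate minimises it, so positivity is
  inherited.\<close>

lemma pos_def_schur:
  assumes pd: "pos_def (Suc N) B"
  shows "\<exists>a>0. B N N = of_real a"
    and "pos_def N (\<lambda>k j. B k j - B k N * B N j / B N N)"
proof -
  have h: "herm (Suc N) B" using pd by (simp add: pos_def_def)
  define a where "a = Re (B N N)"
  have "B N N = cnj (B N N)" by (rule hermD[OF h]) auto
  then have a: "B N N = of_real a" by (simp add: a_def complex_eq_iff)
  define e where "e = (\<lambda>k. if k = N then 1 else 0 :: complex)"
  have "0 < Re (hform (Suc N) B e)"
    using pd unfolding pos_def_def by (auto simp: e_def)
  moreover have "hform N B e = 0" by (simp add: hform_def e_def)
  moreover have "(\<Sum>k<N. cnj (e k) * B k N) = 0"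
    by (rule sum.neutral) (simp add: e_def)
  ultimately have a0: "a > 0"
    unfolding Re_hform_Suc[OF h] by (simp add: a_def e_def)
  show "\<exists>a>0. B N N = of_real a" using a a0 by blast
  show "pos_def N (\<lambda>k j. B k j - B k N * B N j / B N N)"
    unfolding pos_def_def
  proof (intro conjI allI impI)
    have "B j k = cnj (B k j)" if "k \<le> N" "j \<le> N" for k j
      by (rule hermD[OF h]) (use that in auto)
    note * = this
    have "B j k - B j N * B N k / of_real a = cnj (B k j - B k N * B N j / of_real a)" if "k < N" "j < N" for k j
      using *[of k j] *[of j N] *[of N k] that by simp
    then show "herm N (\<lambda>k j. B k j - B k N * B N j / B N N)"
      unfolding herm_def a by blast
  next
    fix v :: "nat \<Rightarrow> complex" assume v: "\<exists>k<N. v k \<noteq> 0"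
    define b where "b = (\<Sum>k<N. cnj (v k) * B k N)"
    \<comment> \<open>The minimising last coordinate: the cross term becomes -2 |b|^2 / a and the
      square term |b|^2 / a, together -|b|^2 / a.\<close>
    define w where "w = v(N := - cnj b / of_real a)"
    have "0 < Re (hform (Suc N) B w)"
      using pd v unfolding pos_def_def w_def by (metis fun_upd_other less_SucI less_irrefl)
    moreover have "hform N B w = hform N B v"
      by (rule hform_cong) (simp add: w_def)
    moreover have "(\<Sum>k<N. cnj (w k) * B k N) = b"
      unfolding b_def by (intro sum.cong) (auto simp: w_def)
    moreover have "b * w N = - of_real ((cmod b)\<^sup>2 / a)"
      by (simp add: w_def complex_norm_square del: of_real_power)
    moreover have "(cmod (w N))\<^sup>2 = (cmod b)\<^sup>2 / a\<^sup>2"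
      by (simp add: w_def norm_divide power_divide)
    ultimately have "0 < Re (hform N B v) - (cmod b)\<^sup>2 / a"
      using a0 unfolding Re_hform_Suc[OF h] by (simp add: a_def[symmetric] power2_eq_square)
    then show "0 < Re (hform N (\<lambda>k j. B k j - B k N * B N j / B N N) v)"
      unfolding hform_schur[OF h] by (simp add: a b_def[symmetric] flip: of_real_divide of_real_power)
  qed
qed

section \<open>Moment generating function of the received energy\<close>

lemma product_prob_space_cgauss: "v > 0 \<Longrightarrow> product_prob_space (\<lambda>_::'i. cgauss v)"
  by (intro product_prob_spaceI prob_space_cgauss)

lemma prob_space_PiM_cgauss: "v > 0 \<Longrightarrow> prob_space (PiM I (\<lambda>_. cgauss v))"
  by (intro prob_space_PiM prob_space_cgauss)

lemma borel_measurable_hform [measurable]: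
  assumes "\<And>k. k < N \<Longrightarrow> (\<lambda>x. f x k) \<in> borel_measurable M"
  shows "(\<lambda>x. hform N B (f x)) \<in> borel_measurable M"
  unfolding hform_def using assms by (intro borel_measurable_sum borel_measurable_times borel_measurable_const
    borel_measurable_continuous_on[of cnj, OF _ assms] continuous_intros) auto

lemma borel_measurable_vsqnorm [measurable]:
  assumes "\<And>i. i < n \<Longrightarrow> (\<lambda>x. f x i) \<in> borel_measurable M"
  shows "(\<lambda>x. vsqnorm n (f x)) \<in> borel_measurable M"
  unfolding vsqnorm_def using assms by (intro borel_measurable_sum) auto

text \<open>Stated up to equality of sigma-algebras so that it serves fading, noise and codebook
  columns alike, whose factor measures differ.\<close>

lemma measurable_nested_component:
  assumes "k \<in> I" "l \<in> J" "\<And>k. k \<in> I \<Longrightarrow> sets (N k) = sets (PiM J (\<lambda>_. borel :: 'a::topological_space measure))"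
  shows "(\<lambda>h. h k l) \<in> borel_measurable (PiM I N)"
proof -
  have "(\<lambda>h. h k) \<in> measurable (PiM I N) (PiM J (\<lambda>_. borel :: 'a measure))"
    using measurable_component_singleton[OF assms(1), of N] measurable_cong_sets[OF refl assms(3)[OF assms(1)]] by blast
  from measurable_compose[OF this measurable_component_singleton[OF assms(2)]] show ?thesis .
qed

lemma sets_PiM_cgauss: "sets (PiM J (\<lambda>_. cgauss v)) = sets (PiM J (\<lambda>_. borel))"
  by (rule sets_PiM_cong) simp_all

lemma measurable_fading_component:
  assumes "k < N" "l < L"
  shows "(\<lambda>h. h k l) \<in> borel_measurable (PiM {..<N} (\<lambda>_. PiM {..<L} (\<lambda>_. cgauss v)))"
  by (rule measurable_nested_component[of _ _ _ "{..<L}"]) (use assms sets_PiM_cgauss in auto)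

lemma nn_integral_PiM_cgauss_prod:
  assumes "v > 0" "finite J" "\<And>l. l \<in> J \<Longrightarrow> f l \<in> borel_measurable borel" 
  shows "(\<integral>\<^sup>+x. (\<Prod>l\<in>J. f l (x l)) \<partial>PiM J (\<lambda>_. cgauss v)) = (\<Prod>l\<in>J. \<integral>\<^sup>+y. f l y \<partial>cgauss v)"
proof -
  interpret product_prob_space "\<lambda>_. cgauss v" by (rule product_prob_space_cgauss) fact
  show ?thesis by (rule product_nn_integral_prod) (use assms in auto)
qed

text \<open>The factor exp(|h|^2) cancels the Gaussian weight, so each antenna contributes a
  normalised integral of exp(-h^H B h), equal to 1 / det B. The induction removes the last user on
  all \<open>L\<close> antennas at once; the pivot comes out to the power -L and the Schur form
  remains. The determinant is positive as a product of pivots.\<close>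

lemma nn_integral_gauss_hform:
  assumes "pos_def N B"
  shows "0 < Re (det (mat N N (\<lambda>(i,j). B i j))) \<and>
    (\<integral>\<^sup>+h. ennreal (exp (\<Sum>l<L. vsqnorm N (\<lambda>k. h k l) - Re (hform N B (\<lambda>k. h k l))))
      \<partial>PiM {..<N} (\<lambda>_. PiM {..<L} (\<lambda>_. cgauss 1))) =
    ennreal ((1 / Re (det (mat N N (\<lambda>(i,j). B i j)))) ^ L)"
  using assms
proof (induction N arbitrary: B)
  case 0
  show ?case by (simp add: PiM_empty nn_integral_count_space_finite vsqnorm_def hform_def)
next
  case (Suc N)
  have herm: "herm (Suc N) B" using Suc.prems by (simp add: pos_def_def)
  obtain a where a: "a > 0" "B N N = of_real a"
    using pos_def_schur(1)[OF Suc.prems] by blast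
  define S where "S = (\<lambda>k j. B k j - B k N * B N j / B N N)"
  have S: "pos_def N S" unfolding S_def by (rule pos_def_schur(2)) fact
  let ?dS = "Re (det (mat N N (\<lambda>(i,j). S i j)))"
  let ?dB = "Re (det (mat (Suc N) (Suc N) (\<lambda>(i,j). B i j)))"
  let ?G = "PiM {..<L} (\<lambda>_. cgauss 1)"
  have det: "?dB = a * ?dS"
    using det_mat_Suc_schur[of B N] a by (simp add: S_def)
  have IH: "0 < ?dS" "(\<integral>\<^sup>+h. ennreal (exp (\<Sum>l<L. vsqnorm N (\<lambda>k. h k l) - Re (hform N S (\<lambda>k. h k l))))
      \<partial>PiM {..<N} (\<lambda>_. ?G)) = ennreal ((1 / ?dS) ^ L)"
    using Suc.IH[OF S] by auto
  interpret G: product_prob_space "\<lambda>_::nat. ?G"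
    by (intro product_prob_spaceI prob_space_PiM_cgauss) simp
  let ?f = "\<lambda>h. ennreal (exp (\<Sum>l<L. vsqnorm (Suc N) (\<lambda>k. h k l) - Re (hform (Suc N) B (\<lambda>k. h k l))))"
  define b where "b = (\<lambda>(h :: nat \<Rightarrow> nat \<Rightarrow> complex) l. \<Sum>k<N. cnj (h k l) * B k N :: complex)"
  define r where "r = (\<lambda>(h :: nat \<Rightarrow> nat \<Rightarrow> complex) l. vsqnorm N (\<lambda>k. h k l) - Re (hform N B (\<lambda>k. h k l)))"
  have step: "(\<integral>\<^sup>+y. ?f (h(N := y)) \<partial>?G) =
      ennreal ((1 / a) ^ L) * ennreal (exp (\<Sum>l<L. vsqnorm N (\<lambda>k. h k l) - Re (hform N S (\<lambda>k. h k l))))" for h :: "nat \<Rightarrow> nat \<Rightarrow> complex"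
  proof -
    \<comment> \<open>The exponent is quadratic in the last user's coefficient with leading
      coefficient 1 - a, where a is the pivot; positivity of the pivot is thus the integrability
      condition.\<close>
    have upd: "vsqnorm (Suc N) (\<lambda>k. (h(N := y)) k l) - Re (hform (Suc N) B (\<lambda>k. (h(N := y)) k l)) =
        r h l + ((1 - a) * (cmod (y l))\<^sup>2 + 2 * Re (- b h l * y l))" for y l
    proof -
      have "vsqnorm (Suc N) (\<lambda>k. (h(N := y)) k l) = vsqnorm N (\<lambda>k. h k l) + (cmod (y l))\<^sup>2"
        by (simp add: vsqnorm_def)
      moreover have "hform N B (\<lambda>k. (h(N := y)) k l) = hform N B (\<lambda>k. h k l)"
        by (rule hform_cong) simp
      moreover have "(\<Sum>k<N. cnj ((h(N := y)) k l) * B k N) = b h l"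
        unfolding b_def by (intro sum.cong) auto
      ultimately show ?thesis
        unfolding Re_hform_Suc[OF herm] by (simp add: r_def a algebra_simps)
    qed
    have "(\<integral>\<^sup>+y. ?f (h(N := y)) \<partial>?G) =
        (\<integral>\<^sup>+y. (\<Prod>l<L. ennreal (exp (r h l)) * ennreal (exp ((1 - a) * (cmod (y l))\<^sup>2 + 2 * Re (- b h l * y l)))) \<partial>?G)"
      unfolding upd by (simp add: exp_sum exp_add prod_ennreal[symmetric] ennreal_mult)
    also have "\<dots> = (\<Prod>l<L. \<integral>\<^sup>+y. ennreal (exp (r h l)) * ennreal (exp ((1 - a) * (cmod y)\<^sup>2 + 2 * Re (- b h l * y))) \<partial>cgauss 1)"
      by (rule nn_integral_PiM_cgauss_prod) simp_all
    also have "\<dots> = (\<Prod>l<L. ennreal (exp (r h l)) * ennreal (exp ((cmod (- b h l))\<^sup>2 / (1 - (1 - a))) / (1 - (1 - a))))"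
      using a by (intro prod.cong refl, subst nn_integral_cmult) (simp, subst nn_integral_cgauss_quadratic, simp_all)
    also have "\<dots> = (\<Prod>l<L. ennreal (1 / a) * ennreal (exp (r h l + (cmod (b h l))\<^sup>2 / a)))"
      using a by (intro prod.cong refl) (simp add: ennreal_mult'[symmetric] exp_add)
    also have "\<dots> = ennreal ((1 / a) ^ L) * ennreal (exp (\<Sum>l<L. r h l + (cmod (b h l))\<^sup>2 / a))"
      using a by (simp add: prod.distrib prod_ennreal exp_sum ennreal_power[symmetric])
    also have "(\<Sum>l<L. r h l + (cmod (b h l))\<^sup>2 / a) =
        (\<Sum>l<L. vsqnorm N (\<lambda>k. h k l) - Re (hform N S (\<lambda>k. h k l)))"
      unfolding S_def hform_schur[OF herm]
      by (intro sum.cong refl) (simp add: r_def b_def a flip: of_real_divide of_real_power)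
    finally show ?thesis .
  qed
  have meas: "(\<lambda>h. vsqnorm m (\<lambda>k. h k l) - Re (hform m B' (\<lambda>k. h k l))) \<in> borel_measurable (PiM {..<m} (\<lambda>_. ?G))"
    if "l < L" for l m B'
    by (intro borel_measurable_diff borel_measurable_vsqnorm measurable_compose[OF borel_measurable_hform borel_measurable_Re]
      measurable_fading_component that) 
  have "(\<integral>\<^sup>+h. ?f h \<partial>PiM (insert N {..<N}) (\<lambda>_. ?G)) = (\<integral>\<^sup>+h. (\<integral>\<^sup>+y. ?f (h(N := y)) \<partial>?G) \<partial>PiM {..<N} (\<lambda>_. ?G))"
  proof (rule G.product_nn_integral_insert)
    show "?f \<in> borel_measurable (PiM (insert N {..<N}) (\<lambda>_. ?G))"
      unfolding lessThan_Suc[symmetric] using meas[of _ "Suc N" B]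
      by (intro measurable_compose[OF _ measurable_ennreal] borel_measurable_exp borel_measurable_sum
          borel_measurable_continuous_on[OF _ borel_measurable_sum, of exp] continuous_intros) auto
  qed auto
  also have "\<dots> = ennreal ((1 / a) ^ L) * (\<integral>\<^sup>+h. ennreal (exp (\<Sum>l<L. vsqnorm N (\<lambda>k. h k l) - Re (hform N S (\<lambda>k. h k l)))) \<partial>PiM {..<N} (\<lambda>_. ?G))"
    unfolding step
    using meas[of _ N S] by (intro nn_integral_cmult measurable_compose[OF _ measurable_ennreal]
          borel_measurable_continuous_on[OF _ borel_measurable_sum, of exp] continuous_intros) auto
  also have "\<dots> = ennreal ((1 / ?dB) ^ L)"
    unfolding IH(2) det using a IH(1) by (simp add: ennreal_mult'[symmetric] power_mult_distrib power_one_over)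
  finally show ?case
    using a IH(1) det by (simp add: lessThan_Suc)
qed

section \<open>Integrating out the noise\<close>

lemma hform_id_minus:
  "hform N (\<lambda>k j. of_bool (k = j) - c * A k j) v = of_real (vsqnorm N v) - c * hform N A v"
proof -
  have "hform N (\<lambda>k j. of_bool (k = j) - c * A k j) v =
      (\<Sum>k<N. \<Sum>j<N. if j = k then cnj (v k) * v j else 0) - c * hform N A v"
    unfolding hform_def sum_distrib_left sum_subtractf[symmetric]
    by (intro sum.cong refl) (auto simp: algebra_simps)
  also have "(\<Sum>k<N. \<Sum>j<N. if j = k then cnj (v k) * v j else 0) = of_real (vsqnorm N v)"
    by (simp add: vsqnorm_def complex_norm_square mult.commute del: of_real_power)
  finally show ?thesis .
qed

text \<open>With the codewords as columns of X this is |X v|^2 = v^H (X^H X) v, which turns signal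
  energy into a form in the fading coefficients.\<close>

lemma vsqnorm_combination_eq_hform:
  "of_real (vsqnorm n (\<lambda>i. \<Sum>k<N. v k * x k i)) = hform N (\<lambda>k j. \<Sum>i<n. cnj (x k i) * x j i) v"
proof -
  have "of_real (vsqnorm n (\<lambda>i. \<Sum>k<N. v k * x k i)) = (\<Sum>i<n. \<Sum>k<N. \<Sum>j<N. cnj (v k * x k i) * (v j * x j i))"
    unfolding vsqnorm_def of_real_sum complex_norm_square
    by (intro sum.cong refl) (subst mult.commute, simp only: cnj_sum sum_product)
  also have "\<dots> = (\<Sum>k<N. \<Sum>i<n. \<Sum>j<N. cnj (v k * x k i) * (v j * x j i))"
    by (rule sum.swap)
  also have "\<dots> = (\<Sum>k<N. \<Sum>j<N. \<Sum>i<n. cnj (v k * x k i) * (v j * x j i))"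
    by (intro sum.cong refl sum.swap)
  also have "\<dots> = hform N (\<lambda>k j. \<Sum>i<n. cnj (x k i) * x j i) v"
    unfolding hform_def sum_distrib_left sum_distrib_right
    by (intro sum.cong refl) (simp add: ac_simps)
  finally show ?thesis .
qed

text \<open>Source of the parameter t = s / (1 - s): completing the square in the noise adds s^2 /
  (1 - s) to the coefficient s of |a|^2, and the sum is s / (1 - s).\<close>

lemma nn_integral_cgauss_shift:
  assumes "s < 1"
  shows "(\<integral>\<^sup>+z. ennreal (exp (s * (cmod (a + z))\<^sup>2)) \<partial>cgauss 1) =
    ennreal (1 / (1 - s) * exp (s / (1 - s) * (cmod a)\<^sup>2))"
proof -
  have sq: "(cmod (a + z))\<^sup>2 = (cmod a)\<^sup>2 + ((cmod z)\<^sup>2 + 2 * Re (cnj a * z))" for z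
    unfolding cmod_power2 by (simp add: power2_eq_square algebra_simps)
  have "(\<integral>\<^sup>+z. ennreal (exp (s * (cmod (a + z))\<^sup>2)) \<partial>cgauss 1) =
      (\<integral>\<^sup>+z. ennreal (exp (s * (cmod a)\<^sup>2)) * ennreal (exp (s * (cmod z)\<^sup>2 + 2 * Re (of_real s * cnj a * z))) \<partial>cgauss 1)"
    unfolding sq by (simp add: ennreal_mult'[symmetric] mult_exp_exp algebra_simps)
  also have "\<dots> = ennreal (exp (s * (cmod a)\<^sup>2)) * (\<integral>\<^sup>+z. ennreal (exp (s * (cmod z)\<^sup>2 + 2 * Re (of_real s * cnj a * z))) \<partial>cgauss 1)"
    by (rule nn_integral_cmult) simp
  also have "\<dots> = ennreal (exp (s * (cmod a)\<^sup>2)) * ennreal (exp ((cmod (of_real s * cnj a))\<^sup>2 / (1 - s)) / (1 - s))"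
    by (subst nn_integral_cgauss_quadratic[OF assms]) simp
  also have "\<dots> = ennreal (1 / (1 - s) * exp (s * (cmod a)\<^sup>2 + s\<^sup>2 * (cmod a)\<^sup>2 / (1 - s)))"
    by (simp add: ennreal_mult'[symmetric] exp_add norm_mult power_mult_distrib)
  also have "s * (cmod a)\<^sup>2 + s\<^sup>2 * (cmod a)\<^sup>2 / (1 - s) = s / (1 - s) * (cmod a)\<^sup>2"
    using assms by (simp add: field_simps power2_eq_square)
  finally show ?thesis .
qed

lemma nn_integral_noise_shift:
  assumes "s < 1"
  shows "(\<integral>\<^sup>+z. ennreal (exp (s * (\<Sum>l<L. vsqnorm n (\<lambda>i. A l i + z l i)))) \<partial>noise_measure n L) =
    ennreal ((1 / (1 - s)) ^ (n * L)) * ennreal (exp (s / (1 - s) * (\<Sum>l<L. vsqnorm n (A l))))"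
proof -
  let ?G = "PiM {..<n} (\<lambda>_. cgauss 1)"
  interpret G: product_prob_space "\<lambda>_::nat. ?G"
    by (intro product_prob_spaceI prob_space_PiM_cgauss) simp
  have s: "1 / (1 - s) \<ge> 0" using assms by simp
  have inner: "(\<integral>\<^sup>+z. ennreal (exp (s * vsqnorm n (\<lambda>i. a i + z i))) \<partial>?G) =
      ennreal ((1 / (1 - s)) ^ n) * ennreal (exp (s / (1 - s) * vsqnorm n a))" for a :: "nat \<Rightarrow> complex"
  proof -
    have "(\<integral>\<^sup>+z. ennreal (exp (s * vsqnorm n (\<lambda>i. a i + z i))) \<partial>?G) =
        (\<integral>\<^sup>+z. (\<Prod>i<n. ennreal (exp (s * (cmod (a i + z i))\<^sup>2))) \<partial>?G)"
      by (simp add: vsqnorm_def sum_distrib_left exp_sum prod_ennreal)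
    also have "\<dots> = (\<Prod>i<n. \<integral>\<^sup>+y. ennreal (exp (s * (cmod (a i + y))\<^sup>2)) \<partial>cgauss 1)"
      by (rule nn_integral_PiM_cgauss_prod) simp_all
    also have "\<dots> = (\<Prod>i<n. ennreal (1 / (1 - s)) * ennreal (exp (s / (1 - s) * (cmod (a i))\<^sup>2)))"
      unfolding nn_integral_cgauss_shift[OF assms] ennreal_mult'[OF s] ..
    also have "\<dots> = ennreal ((1 / (1 - s)) ^ n) * ennreal (exp (s / (1 - s) * vsqnorm n a))"
      using s by (simp add: prod.distrib prod_ennreal exp_sum vsqnorm_def sum_distrib_left ennreal_power del: times_divide_eq_left)
    finally show ?thesis .
  qed
  have "(\<integral>\<^sup>+z. ennreal (exp (s * (\<Sum>l<L. vsqnorm n (\<lambda>i. A l i + z l i)))) \<partial>noise_measure n L) =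
      (\<integral>\<^sup>+z. (\<Prod>l<L. ennreal (exp (s * vsqnorm n (\<lambda>i. A l i + z l i)))) \<partial>PiM {..<L} (\<lambda>_. ?G))"
    by (simp add: noise_measure_def sum_distrib_left exp_sum prod_ennreal)
  also have "\<dots> = (\<Prod>l<L. \<integral>\<^sup>+z. ennreal (exp (s * vsqnorm n (\<lambda>i. A l i + z i))) \<partial>?G)"
  proof (rule G.product_nn_integral_prod)
    fix l
    have "(\<lambda>z. A l i + z i) \<in> borel_measurable ?G" if "i < n" for i
      using that by (intro borel_measurable_add borel_measurable_const measurable_component_singleton[of i _ "\<lambda>_. cgauss 1", simplified measurable_cong_sets[OF refl sets_cgauss]]) simp
    then have "(\<lambda>z. vsqnorm n (\<lambda>i. A l i + z i)) \<in> borel_measurable ?G"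
      by (rule borel_measurable_vsqnorm)
    then show "(\<lambda>z. ennreal (exp (s * vsqnorm n (\<lambda>i. A l i + z i)))) \<in> borel_measurable ?G"
      by simp
  qed simp
  also have "\<dots> = (\<Prod>l<L. ennreal ((1 / (1 - s)) ^ n) * ennreal (exp (s / (1 - s) * vsqnorm n (A l))))"
    unfolding inner ..
  also have "\<dots> = ennreal ((1 / (1 - s)) ^ (n * L)) * ennreal (exp (s / (1 - s) * (\<Sum>l<L. vsqnorm n (A l))))"
    using s by (simp add: prod.distrib prod_ennreal exp_sum sum_distrib_left ennreal_power power_mult del: times_divide_eq_left)
  finally show ?thesis .
qed

lemma prob_space_fading: "prob_space (fading_measure Ka L)"
  unfolding fading_measure_def by (intro prob_space_PiM prob_space_PiM_cgauss) simp

lemma prob_space_noise: "prob_space (noise_measure n L)"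
  unfolding noise_measure_def by (intro prob_space_PiM prob_space_PiM_cgauss) simp

text \<open>The channel output when user \<open>k\<close> sends \<open>x k\<close>, without the truncation built into \<open>xmit\<close>.\<close>

definition outp :: "nat \<Rightarrow> (nat \<Rightarrow> nat \<Rightarrow> complex) \<Rightarrow> (nat \<Rightarrow> nat \<Rightarrow> complex) \<Rightarrow> (nat \<Rightarrow> nat \<Rightarrow> complex)
    \<Rightarrow> nat \<Rightarrow> nat \<Rightarrow> complex" where
  "outp Ka x h z l i = (\<Sum>k<Ka. h k l * x k i) + z l i"

lemma frob2_outp: "frob2 n L (outp Ka x h z) = (\<Sum>l<L. vsqnorm n (\<lambda>i. (\<Sum>k<Ka. h k l * x k i) + z l i))"
  by (simp add: frob2_def vsqnorm_def outp_def)

lemma measurable_frob2_outp: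
  "(\<lambda>(h,z). frob2 n L (outp Ka x h z)) \<in> borel_measurable (fading_measure Ka L \<Otimes>\<^sub>M noise_measure n L)"
proof -
  have 1: "(\<lambda>p. fst p k l) \<in> borel_measurable (fading_measure Ka L \<Otimes>\<^sub>M noise_measure n L)" if "k < Ka" "l < L" for k l
    using measurable_compose[OF measurable_fst measurable_fading_component[OF that]]
    by (simp add: fading_measure_def)
  have 2: "(\<lambda>p. snd p l i) \<in> borel_measurable (fading_measure Ka L \<Otimes>\<^sub>M noise_measure n L)" if "l < L" "i < n" for l i
    using measurable_compose[OF measurable_snd measurable_fading_component[OF that]]
    by (simp add: noise_measure_def)
  show ?thesis
    unfolding frob2_outp case_prod_beta
    by (intro borel_measurable_sum borel_measurable_vsqnorm borel_measurable_add borel_measurable_times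
        borel_measurable_const 1 2) auto
qed

text \<open>The noise yields (1 - s)^(-n L), the fading (det B)^(-L) with B = 1 - t X^H X. They
  merge because (1 - s) t = s gives 1 - s (1 + X X^H) = (1 - s) (1 - t X X^H), after which
  Sylvester's identity applies.\<close>

lemma mgf_frob2_outp:
  fixes x :: "nat \<Rightarrow> nat \<Rightarrow> complex" and s :: real and n Ka :: nat
  defines "D \<equiv> Re (det (1\<^sub>m n - complex_of_real s \<cdot>\<^sub>m (1\<^sub>m n + mat n n (\<lambda>(i,j). \<Sum>k<Ka. x k i * cnj (x k j)))))"
  assumes s: "s < 1"
    and pd: "pos_def Ka (\<lambda>k j. of_bool (k = j) - of_real (s / (1 - s)) * (\<Sum>i<n. cnj (x k i) * x j i))"
  shows "0 < D"
    and "(\<integral>\<^sup>+(h,z). ennreal (exp (s * frob2 n L (outp Ka x h z))) \<partial>(fading_measure Ka L \<Otimes>\<^sub>M noise_measure n L)) =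
      ennreal ((1 / D) ^ L)"
proof -
  define t where "t = s / (1 - s)"
  define B where "B = (\<lambda>k j. of_bool (k = j) - of_real t * (\<Sum>i<n. cnj (x k i) * x j i))"
  let ?dB = "Re (det (mat Ka Ka (\<lambda>(i,j). B i j)))"
  have B: "pos_def Ka B" using pd by (simp add: B_def t_def)
  note G = nn_integral_gauss_hform[OF B, of L]
  have tt: "(1 - s) * t = s" using s by (simp add: t_def)
  have D: "D = (1 - s) ^ n * ?dB"
  proof -
    let ?X = "mat n Ka (\<lambda>(i,k). x k i)" and ?Y = "mat Ka n (\<lambda>(k,j). of_real t * cnj (x k j))"
    let ?g = "mat n n (\<lambda>(i,j). \<Sum>k<Ka. x k i * cnj (x k j))"
    have "1\<^sub>m n - complex_of_real s \<cdot>\<^sub>m (1\<^sub>m n + ?g) = complex_of_real (1 - s) \<cdot>\<^sub>m (1\<^sub>m n - ?X * ?Y)"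
    proof (intro eq_matI)
      fix i j assume ij: "i < dim_row (complex_of_real (1 - s) \<cdot>\<^sub>m (1\<^sub>m n - ?X * ?Y))"
        "j < dim_col (complex_of_real (1 - s) \<cdot>\<^sub>m (1\<^sub>m n - ?X * ?Y))"
      have XY: "(?X * ?Y) $$ (i,j) = of_real t * (\<Sum>k<Ka. x k i * cnj (x k j))"
        using ij by (simp add: scalar_prod_def lessThan_atLeast0 sum_distrib_left ac_simps)
      have st: "complex_of_real s = complex_of_real (1 - s) * complex_of_real t"
        unfolding of_real_mult[symmetric] tt ..
      have "(1\<^sub>m n - complex_of_real s \<cdot>\<^sub>m (1\<^sub>m n + ?g)) $$ (i,j) =
          of_real (1 - s) * of_bool (i = j) - of_real s * (\<Sum>k<Ka. x k i * cnj (x k j))"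
        using ij by (auto simp: algebra_simps)
      also have "\<dots> = of_real (1 - s) * (of_bool (i = j) - of_real t * (\<Sum>k<Ka. x k i * cnj (x k j)))"
        by (simp only: st right_diff_distrib mult.assoc)
      also have "\<dots> = (complex_of_real (1 - s) \<cdot>\<^sub>m (1\<^sub>m n - ?X * ?Y)) $$ (i,j)"
        using ij XY by simp
      finally show "(1\<^sub>m n - complex_of_real s \<cdot>\<^sub>m (1\<^sub>m n + ?g)) $$ (i,j) =
        (complex_of_real (1 - s) \<cdot>\<^sub>m (1\<^sub>m n - ?X * ?Y)) $$ (i,j)" .
    qed auto
    then have "D = Re (complex_of_real (1 - s) ^ n * det (1\<^sub>m n - ?X * ?Y))"
      unfolding D_def by simp
    also have "det (1\<^sub>m n - ?X * ?Y) = det (1\<^sub>m Ka - ?Y * ?X)"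
      by (rule det_one_minus_mult_commute) auto
    also have "1\<^sub>m Ka - ?Y * ?X = mat Ka Ka (\<lambda>(i,j). B i j)"
      by (intro eq_matI) (auto simp: scalar_prod_def B_def lessThan_atLeast0 sum_distrib_left ac_simps)
    finally show ?thesis by (simp only: of_real_power[symmetric] Re_complex_of_real times_complex.sel Im_complex_of_real mult_zero_left diff_zero)
  qed
  show "0 < D" using D G s by simp
  interpret N: prob_space "noise_measure n L" by (rule prob_space_noise)
  let ?F = "fading_measure Ka L" and ?N = "noise_measure n L"
  have "(\<integral>\<^sup>+(h,z). ennreal (exp (s * frob2 n L (outp Ka x h z))) \<partial>(?F \<Otimes>\<^sub>M ?N)) =
      (\<integral>\<^sup>+h. (\<integral>\<^sup>+z. ennreal (exp (s * frob2 n L (outp Ka x h z))) \<partial>?N) \<partial>?F)"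
    using measurable_frob2_outp[of n L Ka x]
    by (subst N.nn_integral_fst[symmetric]) (simp_all add: case_prod_beta)
  also have "\<dots> = (\<integral>\<^sup>+h. ennreal ((1 / (1 - s)) ^ (n * L)) * ennreal (exp (\<Sum>l<L. vsqnorm Ka (\<lambda>k. h k l) - Re (hform Ka B (\<lambda>k. h k l)))) \<partial>?F)"
  proof (rule nn_integral_cong)
    fix h :: "nat \<Rightarrow> nat \<Rightarrow> complex"
    have "t * vsqnorm n (\<lambda>i. \<Sum>k<Ka. h k l * x k i) = vsqnorm Ka (\<lambda>k. h k l) - Re (hform Ka B (\<lambda>k. h k l))" for l
      unfolding B_def hform_id_minus vsqnorm_combination_eq_hform[symmetric] by simp
    then have "t * (\<Sum>l<L. vsqnorm n (\<lambda>i. \<Sum>k<Ka. h k l * x k i)) = (\<Sum>l<L. vsqnorm Ka (\<lambda>k. h k l) - Re (hform Ka B (\<lambda>k. h k l)))"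
      by (simp add: sum_distrib_left)
    then show "(\<integral>\<^sup>+z. ennreal (exp (s * frob2 n L (outp Ka x h z))) \<partial>?N) =
       ennreal ((1 / (1 - s)) ^ (n * L)) * ennreal (exp (\<Sum>l<L. vsqnorm Ka (\<lambda>k. h k l) - Re (hform Ka B (\<lambda>k. h k l))))"
      unfolding frob2_outp nn_integral_noise_shift[OF s] t_def by simp
  qed
  also have "\<dots> = ennreal ((1 / (1 - s)) ^ (n * L)) * (\<integral>\<^sup>+h. ennreal (exp (\<Sum>l<L. vsqnorm Ka (\<lambda>k. h k l) - Re (hform Ka B (\<lambda>k. h k l)))) \<partial>?F)"
  proof (rule nn_integral_cmult)
    have "(\<lambda>h. vsqnorm Ka (\<lambda>k. h k l) - Re (hform Ka B (\<lambda>k. h k l))) \<in> borel_measurable ?F" if "l < L" for l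
      unfolding fading_measure_def
      by (intro borel_measurable_diff borel_measurable_vsqnorm measurable_compose[OF borel_measurable_hform borel_measurable_Re]
        measurable_fading_component that)
    then have "(\<lambda>h. \<Sum>l<L. vsqnorm Ka (\<lambda>k. h k l) - Re (hform Ka B (\<lambda>k. h k l))) \<in> borel_measurable ?F"
      by (intro borel_measurable_sum) auto
    then show "(\<lambda>h. ennreal (exp (\<Sum>l<L. vsqnorm Ka (\<lambda>k. h k l) - Re (hform Ka B (\<lambda>k. h k l))))) \<in> borel_measurable ?F"
      by simp
  qed
  also have "\<dots> = ennreal ((1 / (1 - s)) ^ (n * L)) * ennreal ((1 / ?dB) ^ L)"
    unfolding fading_measure_def using G by simp
  also have "\<dots> = ennreal ((1 / D) ^ L)"
    using s G unfolding D by (simp add: ennreal_mult'[symmetric] power_mult_distrib power_mult power_one_over)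
  finally show "(\<integral>\<^sup>+(h,z). ennreal (exp (s * frob2 n L (outp Ka x h z))) \<partial>(?F \<Otimes>\<^sub>M ?N)) = ennreal ((1 / D) ^ L)" .
qed

section \<open>The largest eigenvalue of a Gram matrix\<close>

lemma vsqnorm_nonneg [simp]: "0 \<le> vsqnorm n v"
  by (simp add: vsqnorm_def sum_nonneg)

lemma vsqnorm_eq_0_iff: "vsqnorm n v = 0 \<longleftrightarrow> (\<forall>i<n. v i = 0)"
  by (auto simp: vsqnorm_def sum_nonneg_eq_0_iff)

lemma vsqnorm_pos: "\<exists>i<n. v i \<noteq> 0 \<Longrightarrow> 0 < vsqnorm n v"
  using vsqnorm_eq_0_iff[of n v] vsqnorm_nonneg[of n v] by (metis less_le)

lemma vsqnorm_scale: "vsqnorm n (\<lambda>i. c * v i) = (cmod c)\<^sup>2 * vsqnorm n v"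
  by (simp add: vsqnorm_def norm_mult power_mult_distrib sum_distrib_left)

lemma hform_scale: "hform n B (\<lambda>i. of_real c * v i) = of_real (c\<^sup>2) * hform n B v"
  unfolding hform_def sum_distrib_left
  by (intro sum.cong refl) (simp add: power2_eq_square)

lemma vsqnorm_diff:
  "vsqnorm n (\<lambda>i. v i - of_real t * w i) =
    vsqnorm n v - 2 * t * Re (\<Sum>i<n. cnj (v i) * w i) + t\<^sup>2 * vsqnorm n w"
proof -
  have "(cmod (v i - of_real t * w i))\<^sup>2 =
      (cmod (v i))\<^sup>2 - 2 * t * Re (cnj (v i) * w i) + t\<^sup>2 * (cmod (w i))\<^sup>2" for i
    unfolding cmod_power2 by (simp add: power2_eq_square algebra_simps)
  then show ?thesis
    by (simp only: vsqnorm_def sum.distrib sum_subtractf sum_distrib_left Re_sum)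
qed

text \<open>The form is nonnegative along the line through \<open>v\<close> in direction \<open>B v\<close> and vanishes at \<open>v\<close>,
  so its linear term, a multiple of the squared norm of \<open>B v\<close>, is zero.\<close>

lemma psd_form_zero_imp_kernel:
  assumes herm: "herm n B" and psd: "\<And>u. 0 \<le> Re (hform n B u)" and zero: "Re (hform n B v) = 0" and "i < n"
  shows "(\<Sum>j<n. B i j * v j) = 0"
proof -
  define r where "r = (\<lambda>i. \<Sum>j<n. B i j * v j)"
  define q where "q = vsqnorm n r"
  define c where "c = Re (hform n B r)"
  define Y where "Y = (\<Sum>k<n. \<Sum>j<n. cnj (r k) * B k j * v j)"
  define X where "X = (\<Sum>k<n. \<Sum>j<n. cnj (v k) * B k j * r j)"
  have "Y = (\<Sum>k<n. cnj (r k) * r k)"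
    unfolding Y_def by (intro sum.cong refl) (simp add: r_def sum_distrib_left mult.assoc)
  then have Y: "Y = of_real q"
    by (simp add: q_def vsqnorm_def complex_norm_square mult.commute del: of_real_power)
  have "cnj Y = (\<Sum>k<n. \<Sum>j<n. cnj (v j) * B j k * r k)"
    unfolding Y_def cnj_sum
    by (intro sum.cong refl) (simp add: hermD[OF herm, symmetric] ac_simps)
  also have "\<dots> = X"
    unfolding X_def by (rule sum.swap)
  finally have X: "X = of_real q" using Y by simp
  have expand: "hform n B (\<lambda>k. v k - of_real e * r k) =
      hform n B v - of_real e * X - of_real e * Y + of_real (e\<^sup>2) * hform n B r" for e
    unfolding hform_def X_def Y_def sum_distrib_left sum_subtractf[symmetric] sum.distrib[symmetric]
    by (intro sum.cong refl) (simp add: algebra_simps power2_eq_square)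
  have ineq: "0 \<le> e\<^sup>2 * c - 2 * e * q" for e
    using psd[of "\<lambda>k. v k - of_real e * r k"] unfolding expand X Y
    by (simp add: zero c_def flip: of_real_power)
  have "q = 0"
  proof (rule ccontr)
    assume "q \<noteq> 0"
    then have q: "q > 0" using vsqnorm_nonneg[of n r] unfolding q_def by linarith
    \<comment> \<open>Small enough that e * c is at most q, half of the opposing 2 q; the added 1
      keeps the denominator nonzero.\<close>
    define e where "e = q / (\<bar>c\<bar> + 1)"
    have e: "e > 0" using q by (simp add: e_def)
    have "0 \<le> e * (e * c - 2 * q)" using ineq[of e] by (simp add: power2_eq_square algebra_simps)
    then have "2 * q \<le> e * c" using e by (simp add: zero_le_mult_iff)
    also have "e * c \<le> e * (\<bar>c\<bar> + 1)" using e by (intro mult_left_mono) auto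
    also have "\<dots> = q" by (simp add: e_def)
    finally show False using q by simp
  qed
  then show ?thesis using \<open>i < n\<close> by (simp add: q_def vsqnorm_eq_0_iff r_def)
qed

text \<open>Entries from \<open>n\<close> on are pinned to 0, since they would otherwise be
  unbounded. The set is then closed inside a product of discs and points, which is compact by
  Tychonoff.\<close>

lemma compact_unit_sphere_fun:
  "compact {v. vsqnorm n v = 1 \<and> (\<forall>i\<ge>n. v i = 0)}"
proof -
  let ?S = "\<lambda>i. if i < n then cball (0::complex) 1 else {0}"
  have "compactin (product_topology (\<lambda>_. euclidean) UNIV) (PiE UNIV ?S)"
    unfolding compactin_PiE by simp
  then have compact: "compact (PiE UNIV ?S)"
    by (simp add: euclidean_product_topology)
  have "continuous_on UNIV (\<lambda>v::nat \<Rightarrow> complex. vsqnorm n v)"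
    unfolding vsqnorm_def by (intro continuous_intros continuous_on_product_coordinates)
  then have closed: "closed {v. vsqnorm n v = 1}"
    by (intro closed_Collect_eq continuous_on_const)
  have "cmod (v i) \<le> 1" if "vsqnorm n v = 1" "i < n" for v i
  proof -
    have "(cmod (v i))\<^sup>2 \<le> vsqnorm n v"
      unfolding vsqnorm_def by (rule member_le_sum[of i "{..<n}" "\<lambda>i. (cmod (v i))\<^sup>2"]) (use that in auto)
    then show ?thesis using that(1) abs_square_le_1[of "cmod (v i)"] by simp
  qed
  then have "{v. vsqnorm n v = 1 \<and> (\<forall>i\<ge>n. v i = 0)} = {v. vsqnorm n v = 1} \<inter> PiE UNIV ?S"
    by (auto simp: PiE_iff not_less split: if_splits)
  then show ?thesis using closed_Int_compact[OF closed compact] by (simp only:)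
qed

text \<open>By compactness the form attains its maximum \<mu> on the unit sphere at some v. Then
  \<mu> 1 - A is positive semidefinite and its form vanishes at v, so v lies in its kernel.\<close>

lemma hermitian_max_eigenvalue:
  assumes herm: "herm n A" and "n \<ge> 1"
  obtains \<mu> v where "\<exists>i<n. v i \<noteq> 0" "\<And>i. i < n \<Longrightarrow> (\<Sum>j<n. A i j * v j) = of_real \<mu> * v i"
    "\<And>u. Re (hform n A u) \<le> \<mu> * vsqnorm n u"
proof -
  let ?S = "{v. vsqnorm n v = 1 \<and> (\<forall>i\<ge>n. v i = 0)}"
  have "(\<lambda>i. if i = 0 then 1 else 0) \<in> ?S"
    using \<open>n \<ge> 1\<close> by (auto simp: vsqnorm_def if_distrib[of cmod] if_distrib[of "\<lambda>x. x\<^sup>2"] cong: if_cong)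
  then have ne: "?S \<noteq> {}" by blast
  have "continuous_on UNIV (\<lambda>v::nat \<Rightarrow> complex. Re (hform n A v))"
    unfolding hform_def by (intro continuous_intros continuous_on_product_coordinates)
  then have "continuous_on ?S (\<lambda>v. Re (hform n A v))"
    by (rule continuous_on_subset) simp
  from continuous_attains_sup[OF compact_unit_sphere_fun ne this]
  obtain v where v: "v \<in> ?S" "\<And>u. u \<in> ?S \<Longrightarrow> Re (hform n A u) \<le> Re (hform n A v)"
    by blast
  define \<mu> where "\<mu> = Re (hform n A v)"
  have bound: "Re (hform n A u) \<le> \<mu> * vsqnorm n u" for u
  proof (cases "vsqnorm n u = 0")
    case True
    then have "hform n A u = hform n A (\<lambda>_. 0)"
      by (intro hform_cong) (simp add: vsqnorm_eq_0_iff)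
    then show ?thesis using True by (simp add: hform_def)
  next
    case False
    then have pos: "vsqnorm n u > 0" using vsqnorm_nonneg[of n u] by linarith
    define c where "c = 1 / sqrt (vsqnorm n u)"
    have c2: "c\<^sup>2 = 1 / vsqnorm n u" using pos by (simp add: c_def power_divide)
    \<comment> \<open>Scaled to norm 1 and cut off at \<open>n\<close> to lie in the compact set;
      the form sees only the first \<open>n\<close> entries.\<close>
    define u' where "u' = (\<lambda>i. if i < n then of_real c * u i else 0)"
    have "vsqnorm n u' = vsqnorm n (\<lambda>i. of_real c * u i)"
      by (simp add: vsqnorm_def u'_def)
    also have "\<dots> = 1" using pos by (simp add: vsqnorm_scale c2)
    finally have "u' \<in> ?S" by (simp add: u'_def)
    then have "Re (hform n A u') \<le> \<mu>" using v(2) by (simp add: \<mu>_def)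
    also have "hform n A u' = hform n A (\<lambda>i. of_real c * u i)"
      by (rule hform_cong) (simp add: u'_def)
    finally show ?thesis using pos by (simp add: hform_scale c2 field_simps del: of_real_power)
  qed
  define B where "B = (\<lambda>i j. of_real \<mu> * of_bool (i = j) - A i j)"
  have hB: "hform n B u = of_real (\<mu> * vsqnorm n u) - hform n A u" for u
  proof -
    have "hform n B u = of_real \<mu> * hform n (\<lambda>k j. of_bool (k = j) - 0 * A k j) u - hform n A u"
      unfolding hform_def B_def sum_distrib_left sum_subtractf[symmetric]
      by (intro sum.cong refl) (simp add: algebra_simps)
    then show ?thesis unfolding hform_id_minus by simp
  qed
  have hermB: "herm n B"
    unfolding herm_def B_def
  proof (intro allI impI)
    fix k j assume "k < n" "j < n"
    from hermD[OF herm this] show "of_real \<mu> * of_bool (j = k) - A j k = cnj (of_real \<mu> * of_bool (k = j) - A k j)"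
      by auto
  qed
  show ?thesis
  proof
    show "\<exists>i<n. v i \<noteq> 0"
      using v(1) vsqnorm_eq_0_iff[of n v] by auto
    show "Re (hform n A u) \<le> \<mu> * vsqnorm n u" for u by (rule bound)
    show "(\<Sum>j<n. A i j * v j) = of_real \<mu> * v i" if "i < n" for i
    proof -
      have "(\<Sum>j<n. B i j * v j) = 0"
        using v(1) bound that by (intro psd_form_zero_imp_kernel[OF hermB]) (auto simp: hB \<mu>_def)
      moreover have "(\<Sum>j<n. B i j * v j) = (\<Sum>j<n. if j = i then of_real \<mu> * v j else 0) - (\<Sum>j<n. A i j * v j)"
        unfolding sum_subtractf[symmetric] B_def by (intro sum.cong refl) (auto simp: algebra_simps)
      ultimately show ?thesis using that by simp
    qed
  qed
qed

text \<open>Makes \<open>Max\<close> in \<open>lam1\<close> a genuine upper bound of the real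
  eigenvalues.\<close>

lemma finite_real_eigenvalues:
  assumes "(A :: complex mat) \<in> carrier_mat n n"
  shows "finite {e::real. eigenvalue A (complex_of_real e)}"
proof -
  have "char_poly A \<noteq> 0"
    using degree_monic_char_poly[OF assms] by auto
  then have "finite {k. poly (char_poly A) k = 0}" by (rule poly_roots_finite)
  then have "finite (complex_of_real -` {k. poly (char_poly A) k = 0})"
    by (rule finite_vimageI) (simp add: inj_on_def)
  then show ?thesis by (simp add: eigenvalue_root_char_poly[OF assms] vimage_def)
qed

text \<open>\<open>lmax\<close> belongs to X X^H, while positivity concerns X^H X. Rather than
  matching the two spectra, the proof applies the Rayleigh bound for X X^H to y = X v. The link to
  \<open>lmax\<close> is that the Rayleigh maximum is one of the eigenvalues over which
  \<open>Max\<close> ranges.\<close>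

lemma
  fixes x :: "nat \<Rightarrow> nat \<Rightarrow> complex" and n Ka :: nat
  defines "lmax \<equiv> Max {e::real. eigenvalue (mat n n (\<lambda>(i,j). \<Sum>k<Ka. x k i * cnj (x k j))) (complex_of_real e)}"
  assumes n: "n \<ge> 1"
  shows max_eigenvalue_outer_gram_nonneg: "0 \<le> lmax"
    and pos_def_id_minus_inner_gram: "0 \<le> t \<Longrightarrow> t * lmax < 1 \<Longrightarrow>
      pos_def Ka (\<lambda>k j. of_bool (k = j) - of_real t * (\<Sum>i<n. cnj (x k i) * x j i))"
proof -
  define A where "A = (\<lambda>i j. \<Sum>k<Ka. x k i * cnj (x k j))"
  let ?G = "mat n n (\<lambda>(i,j). A i j)"
  \<comment> \<open>The combination identity with users and channel uses exchanged and the entries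
    conjugated.\<close>
  have hA: "hform n A u = of_real (vsqnorm Ka (\<lambda>k. \<Sum>i<n. u i * cnj (x k i)))" for u
    by (simp add: vsqnorm_combination_eq_hform A_def)
  have "herm n A" unfolding herm_def A_def by (auto simp: mult.commute)
  then obtain \<mu> v where
    v: "\<exists>i<n. v i \<noteq> 0" "\<And>i. i < n \<Longrightarrow> (\<Sum>j<n. A i j * v j) = of_real \<mu> * v i"
    and bound: "\<And>u. Re (hform n A u) \<le> \<mu> * vsqnorm n u" 
    using n by (rule hermitian_max_eigenvalue) (rule that, assumption+)
  have "vsqnorm n v > 0" using v(1) by (rule vsqnorm_pos)
  moreover have "0 \<le> Re (hform n A v)" unfolding hA by simp
  then have "0 \<le> \<mu> * vsqnorm n v" using bound[of v] by linarith
  ultimately have \<mu>0: "\<mu> \<ge> 0" by (simp add: zero_le_mult_iff)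
  have "eigenvector ?G (vec n v) (of_real \<mu>)"
    unfolding eigenvector_def
  proof (intro conjI)
    show "vec n v \<noteq> 0\<^sub>v (dim_row ?G)" 
    proof
      assume eq: "vec n v = 0\<^sub>v (dim_row ?G)"
      obtain i where i: "i < n" "v i \<noteq> 0" using v(1) by blast
      have "vec_index (vec n v) i = vec_index (0\<^sub>v n) i" using eq by simp
      then show False using i by simp
    qed
    show "?G *\<^sub>v vec n v = complex_of_real \<mu> \<cdot>\<^sub>v vec n v"
    proof (intro eq_vecI)
      fix i assume "i < dim_vec (complex_of_real \<mu> \<cdot>\<^sub>v vec n v)"
      then show "vec_index (?G *\<^sub>v vec n v) i = vec_index (complex_of_real \<mu> \<cdot>\<^sub>v vec n v) i"
        using v(2)[of i] by (simp add: scalar_prod_def lessThan_atLeast0)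
    qed simp
  qed simp
  then have "eigenvalue ?G (of_real \<mu>)" unfolding eigenvalue_def by blast
  then have \<mu>_le: "\<mu> \<le> lmax"
    unfolding lmax_def A_def[symmetric] by (intro Max_ge finite_real_eigenvalues[of _ n]) auto
  then show "0 \<le> lmax" using \<mu>0 by simp
  assume t: "0 \<le> t" "t * lmax < 1"
  have t\<mu>: "t * \<mu> < 1" using mult_left_mono[OF \<mu>_le t(1)] t(2) by linarith
  show "pos_def Ka (\<lambda>k j. of_bool (k = j) - of_real t * (\<Sum>i<n. cnj (x k i) * x j i))"
    unfolding pos_def_def
  proof (intro conjI allI impI)
    show "herm Ka (\<lambda>k j. of_bool (k = j) - of_real t * (\<Sum>i<n. cnj (x k i) * x j i))"
      unfolding herm_def by (auto simp: mult.commute)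
  next
    fix v assume v: "\<exists>k<Ka. v k \<noteq> (0::complex)"
    have vpos: "vsqnorm Ka v > 0" using v by (rule vsqnorm_pos)
    define y where "y = (\<lambda>i. \<Sum>k<Ka. v k * x k i)"
    \<comment> \<open>w = X^H X v, so the inner product of v and w is a = |X v|^2, and |w|^2 \<le>
      \<mu> a. Expanding |v - t w|^2 \<ge> 0 then gives |v|^2 - t a \<ge> t a (1 - t \<mu>).\<close>
    define w where "w = (\<lambda>k. \<Sum>i<n. y i * cnj (x k i))"
    define a where "a = vsqnorm n y"
    have a0: "a \<ge> 0" by (simp add: a_def)
    have w: "vsqnorm Ka w \<le> \<mu> * a"
      using bound[of y] unfolding hA by (simp add: w_def a_def)
    have "(\<Sum>k<Ka. cnj (v k) * w k) = (\<Sum>i<n. \<Sum>k<Ka. y i * cnj (v k * x k i))"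
      unfolding w_def sum_distrib_left by (subst sum.swap) (simp add: ac_simps)
    also have "\<dots> = (\<Sum>i<n. y i * cnj (y i))"
      by (simp add: y_def sum_distrib_left)
    also have "\<dots> = of_real a"
      by (simp add: a_def vsqnorm_def complex_norm_square del: of_real_power)
    finally have "0 \<le> vsqnorm Ka v - 2 * t * a + t\<^sup>2 * vsqnorm Ka w"
      using vsqnorm_diff[of Ka v t w] vsqnorm_nonneg[of Ka "\<lambda>i. v i - of_real t * w i"] by simp
    also have "\<dots> \<le> vsqnorm Ka v - 2 * t * a + t\<^sup>2 * (\<mu> * a)"
      using w by (simp add: mult_left_mono)
    finally have *: "0 \<le> vsqnorm Ka v - 2 * (t * a) + (t * \<mu>) * (t * a)"
      by (simp add: power2_eq_square ac_simps)
    \<comment> \<open>For t a > 0 strictness comes from t \<mu> < 1, otherwise from v being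
      nonzero.\<close>
    have "0 < vsqnorm Ka v - t * a"
    proof (cases "t * a = 0")
      case False
      then have "t * a > 0" using t a0 by (simp add: less_le)
      then have "(t * \<mu>) * (t * a) < 1 * (t * a)" by (rule mult_strict_right_mono[OF t\<mu>])
      then show ?thesis using * by linarith
    qed (use vpos in linarith)
    then show "0 < Re (hform Ka (\<lambda>k j. of_bool (k = j) - of_real t * (\<Sum>i<n. cnj (x k i) * x j i)) v)"
      unfolding hform_id_minus vsqnorm_combination_eq_hform[symmetric] by (simp add: a_def y_def)
  qed
qed

lemma pos_def_id_plus_inner_gram:
  fixes x :: "nat \<Rightarrow> nat \<Rightarrow> complex" and n Ka :: nat
  assumes "t \<le> 0"
  shows "pos_def Ka (\<lambda>k j. of_bool (k = j) - of_real t * (\<Sum>i<n. cnj (x k i) * x j i))"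
  unfolding pos_def_def
proof (intro conjI allI impI)
  show "herm Ka (\<lambda>k j. of_bool (k = j) - of_real t * (\<Sum>i<n. cnj (x k i) * x j i))"
    unfolding herm_def by (auto simp: mult.commute)
next
  fix v assume v: "\<exists>k<Ka. v k \<noteq> (0::complex)"
  have "vsqnorm Ka v > 0" using v by (rule vsqnorm_pos)
  moreover have "t * vsqnorm n (\<lambda>i. \<Sum>k<Ka. v k * x k i) \<le> 0"
    using assms by (simp add: mult_nonpos_nonneg)
  ultimately show "0 < Re (hform Ka (\<lambda>k j. of_bool (k = j) - of_real t * (\<Sum>i<n. cnj (x k i) * x j i)) v)"
    unfolding hform_id_minus vsqnorm_combination_eq_hform[symmetric] by simp
qed

section \<open>Codeword norms\<close>

text \<open>The disc of radius sqrt (a v) has area pi v a, linear in a, so the scaled squared radius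
  pushes planar Lebesgue measure to a constant density on the half-line. This replaces polar
  coordinates.\<close>

lemma distr_lborel_sqnorm:
  fixes v :: real
  assumes "v > 0"
  shows "distr (lborel :: (real \<times> real) measure) borel (\<lambda>p. (norm p)\<^sup>2 / v) =
    density lborel (\<lambda>t. ennreal (pi * v) * indicator {0..} t)" (is "?M = ?N")
proof (rule measure_eqI_generator_eq[where E="range (\<lambda>a::real. {..a})" and \<Omega>=UNIV and A="\<lambda>i. {..real i}"])
  have M: "emeasure ?M {..a} = ennreal (pi * v * max a 0)" for a
  proof -
    have "emeasure ?M {..a} = emeasure lborel {p :: real \<times> real. (norm p)\<^sup>2 / v \<le> a}"
      by (subst emeasure_distr) (auto intro!: arg_cong[where f="emeasure lborel"])
    also have "\<dots> = ennreal (pi * v * max a 0)"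
    proof (cases "a \<ge> 0")
      case True
      have "{p :: real \<times> real. (norm p)\<^sup>2 / v \<le> a} = cball 0 (sqrt (a * v))"
      proof -
        have "(norm p)\<^sup>2 / v \<le> a \<longleftrightarrow> norm p \<le> sqrt (a * v)" for p :: "real \<times> real"
        proof -
          have "(norm p)\<^sup>2 / v \<le> a \<longleftrightarrow> (norm p)\<^sup>2 \<le> (sqrt (a * v))\<^sup>2"
            using assms True by (simp add: field_simps)
          also have "\<dots> \<longleftrightarrow> norm p \<le> sqrt (a * v)"
            using assms True abs_le_square_iff[of "norm p" "sqrt (a * v)"] by simp
          finally show ?thesis .
        qed
        then show ?thesis by (simp add: cball_def)
      qed
      then show ?thesis using assms True
        by (simp add: emeasure_cball unit_ball_vol_2 ac_simps)
    next
      case False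
      then have "\<not> (norm p)\<^sup>2 / v \<le> a" for p :: "real \<times> real"
        using assms by (smt (verit) divide_nonneg_pos zero_le_power2)
      then show ?thesis using False by simp
    qed
    finally show ?thesis .
  qed
  have N: "emeasure ?N {..a} = ennreal (pi * v * max a 0)" for a
  proof -
    have "emeasure ?N {..a} = (\<integral>\<^sup>+t. ennreal (pi * v) * indicator {0..a} t \<partial>lborel)"
      by (subst emeasure_density) (auto intro!: nn_integral_cong split: split_indicator)
    also have "\<dots> = ennreal (pi * v) * emeasure lborel {0..a}"
      by (rule nn_integral_cmult_indicator) simp
    also have "\<dots> = ennreal (pi * v * max a 0)"
      using assms by (cases "a \<ge> 0") (simp_all add: ennreal_mult'[symmetric])
    finally show ?thesis .
  qed
  show "emeasure ?M X = emeasure ?N X" if "X \<in> range (\<lambda>a::real. {..a})" for X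
    using that M N by auto
  show "emeasure ?M {..real i} \<noteq> \<infinity>" for i using M by simp
  show "Int_stable (range (\<lambda>a::real. {..a}))" by (auto simp: Int_stable_def)
  show "sets ?M = sigma_sets UNIV (range (\<lambda>a::real. {..a}))"
    by (simp add: borel_eq_atMost sets_measure_of)
  show "sets ?N = sigma_sets UNIV (range (\<lambda>a::real. {..a}))"
    by (simp add: borel_eq_atMost sets_measure_of)
  show "(\<Union>i. {..real i}) = (UNIV :: real set)"
    using real_arch_simple by auto
qed auto

lemma cgauss_eq_density:
  assumes "v > 0"
  shows "cgauss v = distr (density lborel (\<lambda>p. ennreal (1 / (pi * v) * exp (- ((norm p)\<^sup>2 / v))))) borel (\<lambda>(a,b). Complex a b)"
proof -
  let ?g = "\<lambda>x. ennreal (normal_density 0 (sqrt (v/2)) x)"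
  have "density lborel ?g \<Otimes>\<^sub>M density lborel ?g = density (lborel \<Otimes>\<^sub>M lborel) (\<lambda>(x,y). ?g x * ?g y)"
    using prob_space_real_gauss[OF assms]
    by (intro pair_measure_density) (auto intro: prob_space_imp_sigma_finite simp: lborel.sigma_finite_measure_axioms)
  also have "\<dots> = density lborel (\<lambda>p. ennreal (1 / (pi * v) * exp (- ((norm p)\<^sup>2 / v))))"
    unfolding lborel_prod
  proof (intro arg_cong[where f="density lborel"] ext)
    fix p :: "real \<times> real"
    obtain x y where p: "p = (x,y)" by (cases p)
    have n: "(norm p)\<^sup>2 = x\<^sup>2 + y\<^sup>2" by (simp add: p norm_Pair)
    show "(case p of (x,y) \<Rightarrow> ?g x * ?g y) = ennreal (1 / (pi * v) * exp (- ((norm p)\<^sup>2 / v)))"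
      unfolding n using assms
      by (simp add: p ennreal_mult'[symmetric] normal_density_def mult_exp_exp add_divide_distrib)
  qed
  finally show ?thesis unfolding cgauss_def by simp
qed

text \<open>The planar density depends on the point only through its scaled squared norm and so
  passes through the push-forward; the area constant pi v cancels the normalisation 1 / (pi
  v).\<close>

lemma distributed_cgauss_sqnorm:
  assumes "v > 0"
  shows "distributed (cgauss v) lborel (\<lambda>z. (cmod z)\<^sup>2 / v) (exponential_density 1)"
proof -
  let ?f = "\<lambda>t. ennreal (1 / (pi * v) * exp (- t))"
  let ?X = "\<lambda>p :: real \<times> real. (norm p)\<^sup>2 / v"
  have "distr (cgauss v) lborel (\<lambda>z. (cmod z)\<^sup>2 / v) = distr (cgauss v) borel (\<lambda>z. (cmod z)\<^sup>2 / v)"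
    by (rule distr_cong) auto
  also have "\<dots> = distr (density lborel (\<lambda>p. ?f (?X p))) borel ((\<lambda>z. (cmod z)\<^sup>2 / v) \<circ> (\<lambda>(a,b). Complex a b))"
    unfolding cgauss_eq_density[OF assms]
    by (rule distr_distr) (simp_all add: measurable_Complex[unfolded borel_prod])
  also have "(\<lambda>z. (cmod z)\<^sup>2 / v) \<circ> (\<lambda>(a,b). Complex a b) = ?X"
    by (auto simp: fun_eq_iff cmod_def norm_Pair)
  also have "distr (density lborel (\<lambda>p. ?f (?X p))) borel ?X = density (distr lborel borel ?X) ?f"
    by (rule density_distr[symmetric]) auto
  also have "\<dots> = density lborel (\<lambda>t. ennreal (pi * v) * indicator {0..} t * ?f t)"
    unfolding distr_lborel_sqnorm[OF assms] by (rule density_density_eq) auto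
  also have "(\<lambda>t. ennreal (pi * v) * indicator {0..} t * ?f t) = (\<lambda>t. ennreal (exponential_density 1 t))"
    using assms by (auto simp: fun_eq_iff exponential_density_def ennreal_mult'[symmetric] split: split_indicator)
  finally show ?thesis by (simp add: distributed_def)
qed

section \<open>Erlang tail of the Gaussian codeword norm\<close>

lemma indep_vars_PiM_components:
  assumes "\<And>i. i \<in> I \<Longrightarrow> prob_space (M i)" "I \<noteq> {}"
  shows "prob_space.indep_vars (PiM I M) M (\<lambda>i x. x i) I"
proof -
  interpret prob_space "PiM I M" using assms by (intro prob_space_PiM)
  have "distr (PiM I M) (PiM I M) (\<lambda>x. \<lambda>i\<in>I. x i) = distr (PiM I M) (PiM I M) (\<lambda>x. x)"
    by (intro distr_cong) (auto simp: space_PiM PiE_def extensional_restrict)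
  also have "\<dots> = PiM I M" by simp
  also have "\<dots> = PiM I (\<lambda>i. distr (PiM I M) (M i) (\<lambda>x. x i))"
    using assms by (intro PiM_cong refl) (simp add: distr_PiM_component)
  finally show ?thesis
    using assms by (subst indep_vars_iff_distr_eq_PiM') auto
qed

lemma upper_gamma_eq_erlang:
  assumes "n \<ge> 1" "a \<ge> 0"
  shows "(\<integral>\<^sup>+x. ennreal (erlang_density (n - 1) 1 x) * indicator {a..} x \<partial>lborel) =
      ennreal (upper_gamma (real n) a / Gamma (real n))"
    and "0 \<le> upper_gamma (real n) a / Gamma (real n)"
proof -
  let ?e = "erlang_density (n - 1) 1"
  have Gam: "Gamma (real n) = fact (n - 1)"
    using Gamma_fact[of "n - 1", where ?'a=real] assms by (simp add: of_nat_diff)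
  have int: "integrable lborel ?e"
  proof (rule integrableI_nonneg)
    interpret prob_space "density lborel ?e" by (rule prob_space_erlang_density) simp
    show "(\<integral>\<^sup>+x. ennreal (?e x) \<partial>lborel) < \<infinity>"
      using emeasure_space_1 by (simp add: emeasure_density)
  qed auto
  then have int': "integrable lborel (\<lambda>x. ?e x * indicator {a..} x)"
    by (rule integrable_real_mult_indicator[rotated]) simp
  have "upper_gamma (real n) a = (LINT x|lborel. fact (n - 1) * (?e x * indicator {a..} x))"
    unfolding upper_gamma_def set_lebesgue_integral_def
  proof (rule integral_cong_AE)
    \<comment> \<open>For n = 1 the integrands can differ at 0, where \<open>0 powr 0\<close> is 0
      but \<open>0 ^ 0\<close> is 1; hence only almost everywhere.\<close>
    show "AE x in lborel. indicat_real {a..} x *\<^sub>R (x powr (real n - 1) * exp (- x)) = fact (n - 1) * (?e x * indicator {a..} x)"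
      using AE_lborel_singleton[of 0]
    proof eventually_elim
      case (elim x)
      have "x powr (real n - 1) = x ^ (n - 1)" if "x > 0"
        using that assms by (simp add: powr_realpow[symmetric] of_nat_diff)
      then show ?case using elim assms by (auto simp: erlang_density_def split: split_indicator)
    qed
  qed auto
  then have eq: "upper_gamma (real n) a / Gamma (real n) = (LINT x|lborel. ?e x * indicator {a..} x)"
    unfolding Gam by simp
  have "(\<integral>\<^sup>+x. ennreal (?e x) * indicator {a..} x \<partial>lborel) = (\<integral>\<^sup>+x. ennreal (?e x * indicator {a..} x) \<partial>lborel)"
    by (intro nn_integral_cong) (auto split: split_indicator)
  also have "\<dots> = ennreal (LINT x|lborel. ?e x * indicator {a..} x)"
    by (rule nn_integral_eq_integral[OF int']) auto
  finally show "(\<integral>\<^sup>+x. ennreal (?e x) * indicator {a..} x \<partial>lborel) = ennreal (upper_gamma (real n) a / Gamma (real n))"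
    unfolding eq .
  show "0 \<le> upper_gamma (real n) a / Gamma (real n)"
    unfolding eq by (rule Bochner_Integration.integral_nonneg) auto
qed

text \<open>Divided by \<open>v\<close>, the squared norm is a sum of n independent standard
  exponentials, hence Erlang of shape n, which \<open>erlang_density\<close> indexes by n - 1. The
  inequality comes from closing the half-line.\<close>

lemma gauss_vsqnorm_tail:
  assumes "n \<ge> 1" "v > 0" "r \<ge> 0"
  shows "emeasure (PiM {..<n} (\<lambda>_. cgauss v)) {x \<in> space (PiM {..<n} (\<lambda>_. cgauss v)). r < vsqnorm n x}
    \<le> ennreal (upper_gamma (real n) (r / v) / Gamma (real n))"
proof -
  let ?M = "PiM {..<n} (\<lambda>_. cgauss v)"
  interpret prob_space ?M by (rule prob_space_PiM_cgauss) fact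
  let ?X = "\<lambda>i x. (cmod (x i))\<^sup>2 / v"
  have ne: "{..<n} \<noteq> {}" using assms(1) by (simp add: lessThan_empty_iff)
  have coord: "(\<lambda>x. x i) \<in> measurable ?M (cgauss v)" if "i < n" for i
    using that by (intro measurable_component_singleton) simp
  have "indep_vars (\<lambda>_. cgauss v) (\<lambda>i x. x i) {..<n}"
    by (rule indep_vars_PiM_components) (use assms ne prob_space_cgauss in auto)
  from indep_vars_compose2[OF this, where Y="\<lambda>_ z. (cmod z)\<^sup>2 / v" and N="\<lambda>_. borel"]
  have indep: "indep_vars (\<lambda>_. borel) ?X {..<n}" by simp
  have exp: "distributed ?M lborel (?X i) (exponential_density 1)" if "i \<in> {..<n}" for i
  proof -
    have "distr ?M lborel (?X i) = distr (distr ?M (cgauss v) (\<lambda>x. x i)) lborel (\<lambda>z. (cmod z)\<^sup>2 / v)"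
      using coord that by (subst distr_distr) (auto simp: comp_def)
    also have "distr ?M (cgauss v) (\<lambda>x. x i) = cgauss v"
      using that assms prob_space_cgauss by (intro distr_PiM_component) auto
    also have "distr (cgauss v) lborel (\<lambda>z. (cmod z)\<^sup>2 / v) = density lborel (exponential_density 1)"
      using distributed_cgauss_sqnorm[OF assms(2)] by (simp add: distributed_def)
    finally have *: "distr ?M lborel (?X i) = density lborel (exponential_density 1)" .
    have "?X i \<in> borel_measurable ?M"
      using measurable_compose[OF coord, of i "\<lambda>z. (cmod z)\<^sup>2 / v" borel] that by auto
    then show ?thesis using * by (simp add: distributed_def)
  qed
  have D: "distributed ?M lborel (\<lambda>x. \<Sum>i<n. ?X i x) (erlang_density (card {..<n} - 1) 1)"
    by (rule exponential_distributed_sum[OF _ ne _ exp indep]) auto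
  have "{x \<in> space ?M. r < vsqnorm n x} \<subseteq> (\<lambda>x. \<Sum>i<n. ?X i x) -` {r / v..} \<inter> space ?M"
    using assms(2) by (auto simp: vsqnorm_def sum_divide_distrib[symmetric] intro!: divide_right_mono)
  then have "emeasure ?M {x \<in> space ?M. r < vsqnorm n x} \<le> emeasure ?M ((\<lambda>x. \<Sum>i<n. ?X i x) -` {r / v..} \<inter> space ?M)"
    using distributed_measurable[OF D] by (intro emeasure_mono) (auto simp: measurable_sets)
  also have "\<dots> = (\<integral>\<^sup>+x. ennreal (erlang_density (n - 1) 1 x) * indicator {r / v..} x \<partial>lborel)"
    using distributed_emeasure[OF D, of "{r / v..}"] by simp
  also have "\<dots> = ennreal (upper_gamma (real n) (r / v) / Gamma (real n))"
    by (rule upper_gamma_eq_erlang) (use assms in auto)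
  finally show ?thesis .
qed

text \<open>The ball lies between polydiscs of radii 1 / sqrt n and 1, whose volumes are products of
  disc areas. This is what makes \<open>sphere_unif\<close> a probability measure.\<close>

lemma unit_ball_lebC:
  assumes "n \<ge> 1"
  shows "emeasure (lebC n) {x \<in> space (lebC n). vsqnorm n x \<le> 1} \<noteq> 0"
    and "emeasure (lebC n) {x \<in> space (lebC n). vsqnorm n x \<le> 1} \<noteq> \<infinity>"
proof -
  let ?B = "{x \<in> space (lebC n). vsqnorm n x \<le> 1}"
  interpret product_sigma_finite "\<lambda>_::nat. lborel :: complex measure" ..
  have "(\<lambda>x. vsqnorm n x) \<in> borel_measurable (lebC n)"
    using measurable_component_singleton[of _ "{..<n}" "\<lambda>_. lborel :: complex measure"]
    by (intro borel_measurable_vsqnorm) auto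
  then have B: "?B \<in> sets (lebC n)" by measurable
  have box: "emeasure (lebC n) (PiE {..<n} (\<lambda>_. cball 0 r)) = ennreal (pi * r\<^sup>2) ^ n" if "r \<ge> 0" for r
    using that by (subst emeasure_PiM) (auto simp: emeasure_cball unit_ball_vol_2)
  have boxS: "PiE {..<n} (\<lambda>_. cball 0 r) \<in> sets (lebC n)" for r
    by (rule sets_PiM_I_finite) auto
  have "?B \<subseteq> PiE {..<n} (\<lambda>_. cball 0 1)"
  proof
    fix x assume x: "x \<in> ?B"
    have "cmod (x i) \<le> 1" if "i < n" for i
    proof -
      have "(cmod (x i))\<^sup>2 \<le> vsqnorm n x"
        unfolding vsqnorm_def by (rule member_le_sum[of i "{..<n}" "\<lambda>i. (cmod (x i))\<^sup>2"]) (use that in auto)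
      then have "(cmod (x i))\<^sup>2 \<le> 1" using x by simp
      then show ?thesis using abs_square_le_1[of "cmod (x i)"] by simp
    qed
    then show "x \<in> PiE {..<n} (\<lambda>_. cball 0 1)" using x by (auto simp: space_PiM PiE_iff)
  qed
  from emeasure_mono[OF this boxS] have "emeasure (lebC n) ?B \<le> ennreal (pi * 1\<^sup>2) ^ n"
    by (subst (asm) box) simp_all
  then show "emeasure (lebC n) ?B \<noteq> \<infinity>"
    by (auto simp: ennreal_power top_unique)
  have "PiE {..<n} (\<lambda>_. cball 0 (1 / sqrt n)) \<subseteq> ?B"
  proof
    fix x assume x: "x \<in> PiE {..<n} (\<lambda>_. cball 0 (1 / sqrt n) :: complex set)"
    have "(cmod (x i))\<^sup>2 \<le> 1 / real n" if "i < n" for i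
    proof -
      have "cmod (x i) \<le> 1 / sqrt n" using x that by (auto simp: PiE_iff)
      then have "(cmod (x i))\<^sup>2 \<le> (1 / sqrt n)\<^sup>2" by (intro power_mono) auto
      then show ?thesis by (simp add: power_divide)
    qed
    then have "vsqnorm n x \<le> (\<Sum>i<n. 1 / real n)" unfolding vsqnorm_def by (intro sum_mono) auto
    then show "x \<in> ?B" using x assms by (auto simp: space_PiM PiE_iff)
  qed
  from emeasure_mono[OF this B] have "ennreal (pi * (1 / sqrt n)\<^sup>2) ^ n \<le> emeasure (lebC n) ?B"
    by (subst (asm) box) simp_all
  moreover have "ennreal (pi * (1 / sqrt n)\<^sup>2) ^ n > 0"
    using assms by (simp add: ennreal_power power_divide)
  ultimately show "emeasure (lebC n) ?B \<noteq> 0" by force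
qed

lemma sphere_unif_properties:
  assumes "n \<ge> 1"
  shows "prob_space (sphere_unif n r)"
    and "emeasure (sphere_unif n r) {x \<in> space (sphere_unif n r). r\<^sup>2 < vsqnorm n x} = 0"
proof -
  let ?B = "{x \<in> space (lebC n). vsqnorm n x \<le> 1}"
  let ?U = "uniform_measure (lebC n) ?B"
  let ?f = "\<lambda>x. restrict (\<lambda>i. complex_of_real (r / sqrt (vsqnorm n x)) * x i) {..<n}"
  let ?P = "PiM {..<n} (\<lambda>_. borel :: complex measure)"
  interpret U: prob_space ?U
    by (rule prob_space_uniform_measure) (use unit_ball_lebC[OF assms] in auto)
  have c: "(\<lambda>x. x i) \<in> borel_measurable (lebC n)" if "i < n" for i
    using measurable_component_singleton[of i "{..<n}" "\<lambda>_. lborel :: complex measure"] that by auto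
  then have "(\<lambda>x. vsqnorm n x) \<in> borel_measurable (lebC n)" by (intro borel_measurable_vsqnorm)
  with c have "?f \<in> measurable (lebC n) ?P"
    by (intro measurable_restrict) auto
  then have f: "?f \<in> measurable ?U ?P" by simp
  show "prob_space (sphere_unif n r)"
    unfolding sphere_unif_def by (rule U.prob_space_distr[OF f])
  have "(\<lambda>x. vsqnorm n x) \<in> borel_measurable ?P"
    by (intro borel_measurable_vsqnorm measurable_component_singleton) auto
  then have A: "{x \<in> space ?P. r\<^sup>2 < vsqnorm n x} \<in> sets ?P" by measurable
  \<comment> \<open>Division by zero sends the origin to 0 instead of the sphere; an upper bound
    covers that point without discarding a null set.\<close>
  have "vsqnorm n (?f x) \<le> r\<^sup>2" for x
  proof -
    have "vsqnorm n (?f x) = vsqnorm n (\<lambda>i. complex_of_real (r / sqrt (vsqnorm n x)) * x i)"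
      by (simp add: vsqnorm_def)
    also have "\<dots> = (r / sqrt (vsqnorm n x))\<^sup>2 * vsqnorm n x"
      unfolding vsqnorm_scale norm_of_real power2_abs ..
    also have "\<dots> \<le> r\<^sup>2" by (cases "vsqnorm n x = 0") (simp_all add: power_divide)
    finally show ?thesis .
  qed
  then have "?f -` {x \<in> space ?P. r\<^sup>2 < vsqnorm n x} \<inter> space ?U = {}"
    by (auto simp: not_less[symmetric])
  then show "emeasure (sphere_unif n r) {x \<in> space (sphere_unif n r). r\<^sup>2 < vsqnorm n x} = 0"
    unfolding sphere_unif_def using emeasure_distr[OF f A] by simp
qed

section \<open>Chernoff and union bounds\<close>

text \<open>Regrouping users by message: users who collide give equal summands, which the
  multiplicity in the diagonal matrix counts. The range condition ensures that every user is counted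
  under some m < M.\<close>

lemma gram_eq_sum_users:
  assumes "\<And>k. k < Ka \<Longrightarrow> w k < M"
  shows "gram n M Ka cb w = mat n n (\<lambda>(i,j). \<Sum>k<Ka. cb (w k) i * cnj (cb (w k) j))"
proof -
  have "(\<Sum>m<M. of_nat (card {k. k < Ka \<and> w k = m}) * f m) = (\<Sum>k<Ka. f (w k))" for f :: "nat \<Rightarrow> complex"
  proof -
    have "(\<Sum>m<M. of_nat (card {k. k < Ka \<and> w k = m}) * f m) = (\<Sum>m<M. \<Sum>k\<in>{k\<in>{..<Ka}. w k = m}. f (w k))"
      by (intro sum.cong refl) simp
    also have "\<dots> = (\<Sum>k<Ka. f (w k))"
      by (rule sum.group) (use assms in auto)
    finally show ?thesis .
  qed
  from this[of "\<lambda>m. cb m i * cnj (cb m j)" for i j] show ?thesis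
    unfolding gram_def by (simp add: mult.assoc)
qed

lemma prob_space_fading_noise: "prob_space (fading_measure Ka L \<Otimes>\<^sub>M noise_measure n L)"
proof -
  interpret F: prob_space "fading_measure Ka L" by (rule prob_space_fading)
  interpret N: prob_space "noise_measure n L" by (rule prob_space_noise)
  interpret pair_prob_space "fading_measure Ka L" "noise_measure n L" ..
  show ?thesis by (rule prob_space_axioms)
qed

text \<open>The threshold inequality on \<open>A\<close> is multiplied by \<open>s\<close>, so the
  sign of \<open>s\<close> selects the tail. The Markov step is carried out on the measurable event
  \<open>?A\<close> containing \<open>A\<close>.\<close>

lemma chernoff_frob2_outp:
  fixes x :: "nat \<Rightarrow> nat \<Rightarrow> complex" and s T :: real and n Ka L :: nat
  defines "D \<equiv> Re (det (1\<^sub>m n - complex_of_real s \<cdot>\<^sub>m (1\<^sub>m n + mat n n (\<lambda>(i,j). \<Sum>k<Ka. x k i * cnj (x k j)))))"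
  assumes s: "s < 1"
    and pd: "pos_def Ka (\<lambda>k j. of_bool (k = j) - of_real (s / (1 - s)) * (\<Sum>i<n. cnj (x k i) * x j i))"
    and A: "\<And>h z. (h,z) \<in> A \<Longrightarrow> (h,z) \<in> space (fading_measure Ka L \<Otimes>\<^sub>M noise_measure n L) \<and> s * T \<le> s * frob2 n L (outp Ka x h z)"
  shows "measure (fading_measure Ka L \<Otimes>\<^sub>M noise_measure n L) A \<le> exp (- s * T - real L * ln D)"
proof -
  let ?HZ = "fading_measure Ka L \<Otimes>\<^sub>M noise_measure n L"
  interpret prob_space ?HZ by (rule prob_space_fading_noise)
  note mgf = mgf_frob2_outp(1)[OF s pd, folded D_def] mgf_frob2_outp(2)[OF s pd, where L=L, folded D_def]
  let ?f = "\<lambda>p. s * frob2 n L (outp Ka x (fst p) (snd p))"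
  have f: "?f \<in> borel_measurable ?HZ"
    using measurable_frob2_outp[of n L Ka x] by (simp add: case_prod_beta)
  let ?A = "{p \<in> space ?HZ. s * T \<le> ?f p}"
  have "?A \<in> sets ?HZ" using f by measurable
  then have "emeasure ?HZ A \<le> emeasure ?HZ ?A"
    using A by (intro emeasure_mono) auto
  also have "\<dots> = (\<integral>\<^sup>+p. indicator ?A p \<partial>?HZ)"
    by (rule nn_integral_indicator[symmetric]) fact
  also have "\<dots> \<le> (\<integral>\<^sup>+p. ennreal (exp (- s * T)) * ennreal (exp (?f p)) \<partial>?HZ)"
  proof (intro nn_integral_mono)
    fix p
    show "indicator ?A p \<le> ennreal (exp (- s * T)) * ennreal (exp (?f p))"
      by (auto simp: ennreal_mult'[symmetric] mult_exp_exp split: split_indicator)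
  qed
  also have "\<dots> = ennreal (exp (- s * T)) * (\<integral>\<^sup>+p. ennreal (exp (?f p)) \<partial>?HZ)"
    by (rule nn_integral_cmult) (use f in simp)
  also have "(\<integral>\<^sup>+p. ennreal (exp (?f p)) \<partial>?HZ) = ennreal ((1 / D) ^ L)"
    using mgf(2) by (simp only: case_prod_unfold)
  also have "ennreal (exp (- s * T)) * ennreal ((1 / D) ^ L) = ennreal (exp (- s * T - real L * ln D))"
  proof -
    have "exp (real L * ln D) = D ^ L" using mgf(1) by (simp add: exp_of_nat_mult)
    then show ?thesis using mgf(1) by (simp add: ennreal_mult'[symmetric] exp_diff power_one_over)
  qed
  finally show ?thesis by (simp add: emeasure_eq_measure)
qed

lemma measure_le_p1_integrand:
  assumes w: "\<And>k. k < Ka \<Longrightarrow> w k < M"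
    and A: "\<And>h z. (h,z) \<in> A \<Longrightarrow> (h,z) \<in> space (fading_measure Ka L \<Otimes>\<^sub>M noise_measure n L)
      \<and> frob2 n L (outp Ka (\<lambda>k. cb (w k)) h z) \<le> real n * real L * (1 + Kth * P')"
  shows "measure (fading_measure Ka L \<Otimes>\<^sub>M noise_measure n L) A \<le> p1_integrand n L M Ka P' Kth cb w"
  unfolding p1_integrand_def
proof (rule cINF_greatest)
  fix \<rho> :: real assume \<rho>: "\<rho> \<in> {0..}"
  let ?T = "real n * real L * (1 + Kth * P')"
  let ?F = "1\<^sub>m n + mat n n (\<lambda>(i,j). \<Sum>k<Ka. cb (w k) i * cnj (cb (w k) j))"
  have F: "Fmat n M Ka cb w = ?F"
    unfolding Fmat_def using gram_eq_sum_users[OF w] by simp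
  have "1\<^sub>m n + complex_of_real \<rho> \<cdot>\<^sub>m Fmat n M Ka cb w = 1\<^sub>m n - complex_of_real (- \<rho>) \<cdot>\<^sub>m ?F"
    unfolding F by (intro eq_matI) auto
  moreover have "measure (fading_measure Ka L \<Otimes>\<^sub>M noise_measure n L) A \<le>
     exp (- (- \<rho>) * ?T - real L * ln (Re (det (1\<^sub>m n - complex_of_real (- \<rho>) \<cdot>\<^sub>m ?F))))"
  proof (rule chernoff_frob2_outp)
    show "- \<rho> < 1" using \<rho> by simp
    have "- \<rho> / (1 - - \<rho>) \<le> 0" using \<rho> by simp
    then show "pos_def Ka (\<lambda>k j. of_bool (k = j) - of_real (- \<rho> / (1 - - \<rho>)) * (\<Sum>i<n. cnj (cb (w k) i) * cb (w j) i))"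
      by (rule pos_def_id_plus_inner_gram)
    show "(h,z) \<in> space (fading_measure Ka L \<Otimes>\<^sub>M noise_measure n L) \<and> - \<rho> * ?T \<le> - \<rho> * frob2 n L (outp Ka (\<lambda>k. cb (w k)) h z)"
      if "(h,z) \<in> A" for h z
      using A[OF that] \<rho> by (auto intro: mult_left_mono)
  qed
  ultimately show "measure (fading_measure Ka L \<Otimes>\<^sub>M noise_measure n L) A \<le> exp (\<rho> * real n * real L * (1 + Kth * P')
        - real L * ln (Re (det (1\<^sub>m n + complex_of_real \<rho> \<cdot>\<^sub>m Fmat n M Ka cb w))))"
    by (simp add: mult.assoc)
qed simp

text \<open>Nonnegativity of \<open>lam1\<close> keeps the range of \<rho> nonempty, so that the
  infimum is genuine, and forces \<rho> < 1.\<close>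

lemma measure_le_p2_integrand:
  assumes n: "n \<ge> 1" and w: "\<And>k. k < Ka \<Longrightarrow> w k < M"
    and A: "\<And>h z. (h,z) \<in> A \<Longrightarrow> (h,z) \<in> space (fading_measure Ka L \<Otimes>\<^sub>M noise_measure n L)
      \<and> real n * real L * (1 + Kth * P') \<le> frob2 n L (outp Ka (\<lambda>k. cb (w k)) h z)"
  shows "measure (fading_measure Ka L \<Otimes>\<^sub>M noise_measure n L) A \<le> p2_integrand n L M Ka P' Kth cb w"
  unfolding p2_integrand_def
proof (rule cINF_greatest)
  define x where "x = (\<lambda>k. cb (w k))"
  let ?lam = "lam1 n M Ka cb w"
  let ?F = "1\<^sub>m n + mat n n (\<lambda>(i,j). \<Sum>k<Ka. x k i * cnj (x k j))"
  have gram: "gram n M Ka cb w = mat n n (\<lambda>(i,j). \<Sum>k<Ka. x k i * cnj (x k j))"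
    unfolding x_def by (rule gram_eq_sum_users[OF w])
  have lam: "?lam = Max {e::real. eigenvalue (mat n n (\<lambda>(i,j). \<Sum>k<Ka. x k i * cnj (x k j))) (complex_of_real e)}"
    unfolding lam1_def gram ..
  have lam0: "0 \<le> ?lam"
    unfolding lam by (rule max_eigenvalue_outer_gram_nonneg[OF n])
  then show "{0..<1 / (1 + ?lam)} \<noteq> {}" by simp
  fix \<rho> :: real assume \<rho>: "\<rho> \<in> {0..<1 / (1 + ?lam)}"
  then have \<rho>1: "\<rho> * (1 + ?lam) < 1" using lam0 by (simp add: field_simps)
  have "0 \<le> \<rho> * ?lam" using \<rho> lam0 by simp
  then have \<rho>2: "\<rho> < 1" using \<rho>1 by (simp add: distrib_left)
  let ?T = "real n * real L * (1 + Kth * P')"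
  have F: "Fmat n M Ka cb w = ?F"
    unfolding Fmat_def gram ..
  have "measure (fading_measure Ka L \<Otimes>\<^sub>M noise_measure n L) A \<le>
     exp (- \<rho> * ?T - real L * ln (Re (det (1\<^sub>m n - complex_of_real \<rho> \<cdot>\<^sub>m ?F))))"
  proof (rule chernoff_frob2_outp[OF \<rho>2])
    \<comment> \<open>The second bound is \<open>\<rho>1\<close> rearranged to \<rho> * lam1 < 1 -
      \<rho> and divided by 1 - \<rho>.\<close>
    have "0 \<le> \<rho> / (1 - \<rho>)" "\<rho> / (1 - \<rho>) * ?lam < 1"
      using \<rho> \<rho>1 \<rho>2 by (auto simp: field_simps)
    then show "pos_def Ka (\<lambda>k j. of_bool (k = j) - of_real (\<rho> / (1 - \<rho>)) * (\<Sum>i<n. cnj (x k i) * x j i))"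
      unfolding lam by (rule pos_def_id_minus_inner_gram[OF n])
    show "(h,z) \<in> space (fading_measure Ka L \<Otimes>\<^sub>M noise_measure n L) \<and> \<rho> * ?T \<le> \<rho> * frob2 n L (outp Ka x h z)"
      if "(h,z) \<in> A" for h z
      using A[OF that] \<rho> by (auto simp: x_def intro: mult_left_mono)
  qed
  then show "measure (fading_measure Ka L \<Otimes>\<^sub>M noise_measure n L) A \<le> exp (- \<rho> * real n * real L * (1 + Kth * P')
        - real L * ln (Re (det (1\<^sub>m n - complex_of_real \<rho> \<cdot>\<^sub>m Fmat n M Ka cb w))))"
    unfolding F by (simp add: mult.assoc)
qed

section \<open>The power constraint and the union bound\<close>

definition overpower :: "bool \<Rightarrow> nat \<Rightarrow> real \<Rightarrow> real \<Rightarrow> real" where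
  "overpower sph n P P' = (if sph then 0 else upper_gamma (real n) (real n * P / P') / Gamma (real n))"

lemma p0_eq: "p0 sph n Ka P P' = real Ka * overpower sph n P P'"
  by (simp add: p0_def overpower_def)

lemma overpower_nonneg:
  assumes "n \<ge> 1" "P > 0" "P' > 0" shows "0 \<le> overpower sph n P P'"
  using assms upper_gamma_eq_erlang(2)[of n "real n * P / P'"] by (simp add: overpower_def)

lemma sets_col_dist: "sets (col_dist sph n P P') = sets (PiM {..<n} (\<lambda>_. borel))"
  unfolding col_dist_def sphere_unif_def by (simp add: sets_PiM_cgauss)

lemma
  assumes "n \<ge> 1" "P > 0" "P' > 0"
  shows prob_space_col_dist: "prob_space (col_dist sph n P P')"
    and col_dist_overpower: "emeasure (col_dist sph n P P') {x \<in> space (col_dist sph n P P'). real n * P < vsqnorm n x}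
      \<le> ennreal (overpower sph n P P')"
proof -
  show "prob_space (col_dist sph n P P')"
    using assms by (simp add: col_dist_def sphere_unif_properties prob_space_PiM_cgauss)
  have "(sqrt (real n * P))\<^sup>2 = real n * P" using assms by simp
  then show "emeasure (col_dist sph n P P') {x \<in> space (col_dist sph n P P'). real n * P < vsqnorm n x}
      \<le> ennreal (overpower sph n P P')"
    using assms sphere_unif_properties(2)[of n "sqrt (real n * P)"] gauss_vsqnorm_tail[of n P' "real n * P"]
    by (simp add: col_dist_def overpower_def)
qed

text \<open>
  The bound \<open>bnd\<close> (an infimum over uncountably many parameters) need not be measurable, so its integral is
  only a lower integral and the integral of \<open>bnd\<close> plus an indicator cannot be split; the measurable
  conditional probability \<open>g\<close> is split instead.
\<close>

lemma slice_bound_imp_union_bound: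
  fixes Ka M n L :: nat and P P' :: real and sph :: bool and bnd :: "(nat \<Rightarrow> nat \<Rightarrow> complex) \<Rightarrow> (nat \<Rightarrow> nat) \<Rightarrow> ennreal"
  defines "C \<equiv> codebook_measure sph n M P P'" and "W \<equiv> msg_measure Ka M"
    and "HZ \<equiv> fading_measure Ka L \<Otimes>\<^sub>M noise_measure n L"
  assumes pos: "n \<ge> 1" "M \<ge> 1" "P > 0" "P' > 0"
    and slice: "\<And>cb w. (\<And>k. k < Ka \<Longrightarrow> w k < M) \<Longrightarrow> (\<And>k. k < Ka \<Longrightarrow> vsqnorm n (cb (w k)) \<le> real n * P) \<Longrightarrow>
      emeasure HZ {p. (cb, w, p) \<in> E} \<le> bnd cb w"
  shows "emeasure (scheme_space sph n L M P P' Ka) E \<le> (\<integral>\<^sup>+(cb,w). bnd cb w \<partial>(C \<Otimes>\<^sub>M W)) + ennreal (p0 sph n Ka P P')"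
proof (cases "E \<in> sets (scheme_space sph n L M P P' Ka)")
  case False
  \<comment> \<open>Outside the sigma-algebra \<open>emeasure\<close> defaults to 0.\<close>
  then show ?thesis by (simp add: emeasure_notin_sets)
next
  case True
  let ?q = "ennreal (overpower sph n P P')"
  have col: "prob_space (col_dist sph n P P')"
    using pos by (intro prob_space_col_dist)
  interpret Col: product_prob_space "\<lambda>_::nat. col_dist sph n P P'" "{..<M}"
    by (intro product_prob_spaceI col)
  interpret C: prob_space C
    unfolding C_def codebook_measure_def by (intro prob_space_PiM col)
  interpret W: prob_space W
    unfolding W_def msg_measure_def by (intro prob_space_PiM prob_space_measure_pmf)
  interpret HZ: prob_space HZ unfolding HZ_def by (rule prob_space_fading_noise)
  interpret CW: pair_prob_space C W ..
  interpret WHZ: pair_prob_space W HZ ..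
  have S: "scheme_space sph n L M P P' Ka = C \<Otimes>\<^sub>M (W \<Otimes>\<^sub>M HZ)"
    by (simp add: scheme_space_def C_def W_def HZ_def)
  have E[measurable]: "E \<in> sets (C \<Otimes>\<^sub>M (W \<Otimes>\<^sub>M HZ))" using True S by simp
  define g where "g = (\<lambda>q. \<integral>\<^sup>+p. indicator E (fst q, snd q, p) \<partial>HZ)"
  have g[measurable]: "g \<in> borel_measurable (C \<Otimes>\<^sub>M W)"
    unfolding g_def by measurable
  have g_eq: "g (cb,w) = emeasure HZ {p. (cb,w,p) \<in> E}" if "cb \<in> space C" "w \<in> space W" for cb w
  proof -
    have "Pair w -` (Pair cb -` E) \<in> sets HZ" using E by (intro sets_Pair1)
    moreover have "Pair w -` (Pair cb -` E) = {p. (cb,w,p) \<in> E}" by auto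
    moreover have "(\<lambda>p. indicator E (cb,w,p) :: ennreal) = indicator {p. (cb,w,p) \<in> E}"
      by (auto simp: fun_eq_iff split: split_indicator)
    ultimately show ?thesis by (simp add: g_def)
  qed
  have "emeasure (scheme_space sph n L M P P' Ka) E = (\<integral>\<^sup>+q. indicator E q \<partial>(C \<Otimes>\<^sub>M (W \<Otimes>\<^sub>M HZ)))"
    unfolding S by simp
  also have "\<dots> = (\<integral>\<^sup>+cb. \<integral>\<^sup>+r. indicator E (cb, r) \<partial>(W \<Otimes>\<^sub>M HZ) \<partial>C)"
    by (rule WHZ.nn_integral_fst[symmetric]) simp
  also have "\<dots> = (\<integral>\<^sup>+cb. \<integral>\<^sup>+w. g (cb,w) \<partial>W \<partial>C)"
  proof (intro nn_integral_cong)
    fix cb assume [measurable]: "cb \<in> space C"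
    show "(\<integral>\<^sup>+r. indicator E (cb, r) \<partial>(W \<Otimes>\<^sub>M HZ)) = (\<integral>\<^sup>+w. g (cb,w) \<partial>W)"
      unfolding g_def by (subst HZ.nn_integral_fst[symmetric]) (simp, simp)
  qed
  also have "\<dots> = (\<integral>\<^sup>+q. g q \<partial>(C \<Otimes>\<^sub>M W))"
    by (rule W.nn_integral_fst) simp
  finally have main: "emeasure (scheme_space sph n L M P P' Ka) E = (\<integral>\<^sup>+q. g q \<partial>(C \<Otimes>\<^sub>M W))" .

  txt \<open>Messages outside \<open>{..<M}\<close> have probability zero but do lie in the sample space.\<close>
  define A where "A = (\<lambda>k. {q \<in> space (C \<Otimes>\<^sub>M W). M \<le> snd q k \<or> (\<exists>m<M. snd q k = m \<and> real n * P < vsqnorm n (fst q m))})"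
  have A[measurable]: "A k \<in> sets (C \<Otimes>\<^sub>M W)" if "k < Ka" for k
  proof -
    have "(\<lambda>w. w k) \<in> measurable W (measure_pmf (pmf_of_set {..<M}))"
      unfolding W_def msg_measure_def using that by (intro measurable_component_singleton) simp
    then have [measurable]: "(\<lambda>w. w k) \<in> measurable W (count_space UNIV)"
      by simp
    have vsq: "(\<lambda>cb. vsqnorm n (cb m)) \<in> borel_measurable C" if "m < M" for m
      unfolding C_def codebook_measure_def
      by (intro borel_measurable_vsqnorm measurable_nested_component[of _ _ _ "{..<n}"])
        (use that sets_col_dist in auto)
    have "A k = {q \<in> space (C \<Otimes>\<^sub>M W). M \<le> snd q k} \<union>
        (\<Union>m\<in>{..<M}. {q \<in> space (C \<Otimes>\<^sub>M W). snd q k = m \<and> real n * P < vsqnorm n (fst q m)})"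
      by (auto simp: A_def)
    also have "\<dots> \<in> sets (C \<Otimes>\<^sub>M W)"
    proof (intro sets.Un sets.finite_UN)
      show "{q \<in> space (C \<Otimes>\<^sub>M W). M \<le> snd q k} \<in> sets (C \<Otimes>\<^sub>M W)" by measurable
      show "{q \<in> space (C \<Otimes>\<^sub>M W). snd q k = m \<and> real n * P < vsqnorm n (fst q m)} \<in> sets (C \<Otimes>\<^sub>M W)" if "m \<in> {..<M}" for m
      proof -
        have [measurable]: "(\<lambda>cb. vsqnorm n (cb m)) \<in> borel_measurable C" using that by (intro vsq) simp
        show ?thesis by measurable
      qed
    qed simp
    finally show ?thesis .
  qed
  have A_le: "emeasure (C \<Otimes>\<^sub>M W) (A k) \<le> ?q" if k: "k < Ka" for k
  proof -
    \<comment> \<open>Slicing at fixed messages: user k's codeword is then one fixed column, with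
      law \<open>col_dist\<close>, rather than a column with random index.\<close>
    have "emeasure (C \<Otimes>\<^sub>M W) (A k) = (\<integral>\<^sup>+w. emeasure C ((\<lambda>cb. (cb, w)) -` A k) \<partial>W)"
      using A[OF k] by (rule CW.emeasure_pair_measure_alt2)
    also have "\<dots> \<le> (\<integral>\<^sup>+w. ?q \<partial>W)"
    proof (rule nn_integral_mono_AE)
      have "AE m in measure_pmf (pmf_of_set {..<M}). m < M"
        using pos(2) by (auto simp: AE_measure_pmf_iff lessThan_empty_iff)
      then have "AE w in W. w k < M"
        unfolding W_def msg_measure_def using k by (intro AE_PiM_component) (auto intro: prob_space_measure_pmf)
      then show "AE w in W. emeasure C ((\<lambda>cb. (cb, w)) -` A k) \<le> ?q"
      proof eventually_elim
        case (elim w)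
        let ?D = "col_dist sph n P P'"
        let ?T = "{x \<in> space ?D. real n * P < vsqnorm n x}"
        have "(\<lambda>x. vsqnorm n x) \<in> borel_measurable (PiM {..<n} (\<lambda>_. borel :: complex measure))"
          by (intro borel_measurable_vsqnorm measurable_component_singleton) auto
        then have "(\<lambda>x. vsqnorm n x) \<in> borel_measurable ?D"
          using measurable_cong_sets[OF sets_col_dist refl] by blast
        then have T: "?T \<in> sets ?D" by measurable
        have "{cb \<in> space C. cb (w k) \<in> ?T} \<in> sets C"
          unfolding C_def codebook_measure_def using elim T by (intro measurable_sets_Collect[OF measurable_component_singleton]) auto
        then have "emeasure C ((\<lambda>cb. (cb, w)) -` A k) \<le> emeasure C {cb \<in> space C. cb (w k) \<in> ?T}"
          using elim by (intro emeasure_mono) (auto simp: A_def space_pair_measure C_def codebook_measure_def space_PiM PiE_iff)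
        also have "\<dots> = emeasure ?D ?T"
          unfolding C_def codebook_measure_def using elim T by (intro Col.emeasure_PiM_Collect_single) auto
        also have "\<dots> \<le> ?q" using pos by (intro col_dist_overpower)
        finally show ?case .
      qed
    qed
    also have "\<dots> = ?q" by (simp add: W.emeasure_space_1)
    finally show ?thesis .
  qed
  define B where "B = (\<Union>k<Ka. A k)"
  have B[measurable]: "B \<in> sets (C \<Otimes>\<^sub>M W)" unfolding B_def using A by auto
  have B_le: "emeasure (C \<Otimes>\<^sub>M W) B \<le> ennreal (p0 sph n Ka P P')"
  proof -
    have "emeasure (C \<Otimes>\<^sub>M W) B \<le> (\<Sum>k<Ka. emeasure (C \<Otimes>\<^sub>M W) (A k))"
      unfolding B_def using A by (intro emeasure_subadditive_finite) auto
    also have "\<dots> \<le> (\<Sum>k<Ka. ?q)" using A_le by (intro sum_mono) auto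
    also have "\<dots> = ennreal (p0 sph n Ka P P')"
      using overpower_nonneg[of n P P' sph] pos by (simp add: p0_eq ennreal_mult ennreal_of_nat_eq_real_of_nat)
    finally show ?thesis .
  qed
  have g1: "g q \<le> 1" for q
  proof -
    have "g q \<le> (\<integral>\<^sup>+p. 1 \<partial>HZ)" unfolding g_def by (intro nn_integral_mono) (auto split: split_indicator)
    then show ?thesis by (simp add: HZ.emeasure_space_1)
  qed
  have "(\<integral>\<^sup>+q. g q \<partial>(C \<Otimes>\<^sub>M W)) = (\<integral>\<^sup>+q. g q * indicator (space (C \<Otimes>\<^sub>M W) - B) q + g q * indicator B q \<partial>(C \<Otimes>\<^sub>M W))"
    by (intro nn_integral_cong) (auto split: split_indicator)
  also have "\<dots> = (\<integral>\<^sup>+q. g q * indicator (space (C \<Otimes>\<^sub>M W) - B) q \<partial>(C \<Otimes>\<^sub>M W)) + (\<integral>\<^sup>+q. g q * indicator B q \<partial>(C \<Otimes>\<^sub>M W))"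
    by (rule nn_integral_add) auto
  also have "\<dots> \<le> (\<integral>\<^sup>+(cb,w). bnd cb w \<partial>(C \<Otimes>\<^sub>M W)) + (\<integral>\<^sup>+q. indicator B q \<partial>(C \<Otimes>\<^sub>M W))"
  proof (intro add_mono nn_integral_mono)
    fix q assume q: "q \<in> space (C \<Otimes>\<^sub>M W)"
    obtain cb w where cw: "q = (cb,w)" "cb \<in> space C" "w \<in> space W"
      using q by (auto simp: space_pair_measure)
    show "g q * indicator (space (C \<Otimes>\<^sub>M W) - B) q \<le> (case q of (cb,w) \<Rightarrow> bnd cb w)"
    proof (cases "q \<in> B")
      case False
      have "w k < M" "vsqnorm n (cb (w k)) \<le> real n * P" if "k < Ka" for k
        using False that q cw by (auto simp: B_def A_def not_le not_less)
      then have "emeasure HZ {p. (cb,w,p) \<in> E} \<le> bnd cb w" by (rule slice)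
      then show ?thesis using False q g_eq[OF cw(2,3)] cw(1) by simp
    qed simp
    show "g q * indicator B q \<le> indicator B q"
      using g1[of q] by (auto split: split_indicator)
  qed
  also have "(\<integral>\<^sup>+q. indicator B q \<partial>(C \<Otimes>\<^sub>M W)) \<le> ennreal (p0 sph n Ka P P')"
    using B_le by simp
  finally show ?thesis unfolding main by (simp add: add_left_mono)
qed

section \<open>The nearest-energy decision\<close>

lemma frob2_rx_eq_outp:
  assumes "\<And>k. k < Ka \<Longrightarrow> vsqnorm n (cb (w k)) \<le> real n * P"
  shows "frob2 n L (rx n P Ka cb w h z) = frob2 n L (outp Ka (\<lambda>k. cb (w k)) h z)"
  using assms by (simp add: frob2_def rx_def outp_def xmit_def)

text \<open>\<open>P'\<close> ranges over all admissible values, so the minimising one is covered.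
  \<open>est_event\<close> only asks that \<open>Kest\<close> attain the minimum, hence it contains
  the error event under any tie-breaking rule.\<close>

theorem theorem1:
  fixes n L M K Ka Kest :: nat and P P' :: real and sph :: bool
  assumes "n \<ge> 1" "L \<ge> 1" "M \<ge> 1" "K \<ge> 1"
    and "P > 0" and "Ka \<le> K"
    and "0 < P'" "P' \<le> P" "sph \<Longrightarrow> P' = P"
    and "Kest \<le> K" "Kest \<noteq> Ka"
  shows "emeasure (scheme_space sph n L M P P' Ka) (est_event sph n L M K P P' Ka Kest)
           \<le> p_new sph n L M K Ka P P' Kest + ennreal (p0 sph n Ka P P')"
proof -
  let ?E = "est_event sph n L M K P P' Ka Kest"
  let ?HZ = "fading_measure Ka L \<Otimes>\<^sub>M noise_measure n L"
  let ?F = "\<lambda>Kt. (if Kest < Kt then p1 sph n L M Ka P P' ((real Kest + real Kt) / 2) else 0)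
              + (if Kest > Kt then p2 sph n L M Ka P P' ((real Kest + real Kt) / 2) else 0)"
  interpret HZ: prob_space ?HZ by (rule prob_space_fading_noise)
  have nL: "real n * real L > 0" using assms by simp
  have "{0..K} - {Kest} \<noteq> {}"
  proof -
    \<comment> \<open>K \<ge> 1 provides a candidate other than \<open>Kest\<close>, so
      \<open>Min\<close> is attained.\<close>
    have "(if Kest = 0 then 1 else 0) \<in> {0..K} - {Kest}" using assms(4) by auto
    then show ?thesis by blast
  qed
  then have "p_new sph n L M K Ka P P' Kest \<in> ?F ` ({0..K} - {Kest})"
    unfolding p_new_def by (intro Min_in) auto
  \<comment> \<open>Only the comparison with the minimising competitor is kept; discarding the
    others enlarges the event.\<close>
  then obtain Kt where p_new: "p_new sph n L M K Ka P P' Kest = ?F Kt" and "Kt \<in> {0..K} - {Kest}"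
    by (rule imageE)
  then have Kt: "Kt \<le> K" "Kt \<noteq> Kest" by auto
  let ?Kth = "(real Kest + real Kt) / 2"
  let ?T = "real n * real L * (1 + ?Kth * P')"
  have slice: "(h,z) \<in> space ?HZ \<and>
      (Kest < Kt \<longrightarrow> frob2 n L (outp Ka (\<lambda>k. cb (w k)) h z) \<le> ?T) \<and>
      (Kt < Kest \<longrightarrow> ?T \<le> frob2 n L (outp Ka (\<lambda>k. cb (w k)) h z))"
    if E: "(h,z) \<in> {p. (cb,w,p) \<in> ?E}" and pw: "\<And>k. k < Ka \<Longrightarrow> vsqnorm n (cb (w k)) \<le> real n * P" for cb w h z
  proof -
    define y where "y = frob2 n L (outp Ka (\<lambda>k. cb (w k)) h z)"
    define a where "a = real n * real L * (1 + real Kest * P')"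
    define b where "b = real n * real L * (1 + real Kt * P')"
    \<comment> \<open>Expected energy is affine in the number of users, so the threshold is the
      midpoint of a and b, and a point no farther from a than from b lies on the side of a. Ties sit
      on the midpoint, hence the non-strict bounds.\<close>
    have T: "?T = (a + b) / 2" by (simp add: a_def b_def field_simps)
    have "is_est n L K P' y Kest"
      using E frob2_rx_eq_outp[of Ka n cb w P, OF pw] by (simp add: est_event_def y_def)
    then have ab: "\<bar>y - a\<bar> \<le> \<bar>y - b\<bar>"
      using Kt(1) by (simp add: is_est_def a_def b_def)
    have "a < b" if "Kest < Kt"
      unfolding a_def b_def using that nL assms(7) by (intro mult_strict_left_mono) auto
    moreover have "b < a" if "Kt < Kest"
      unfolding a_def b_def using that nL assms(7) by (intro mult_strict_left_mono) auto
    moreover have "(h,z) \<in> space ?HZ"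
      using E by (simp add: est_event_def scheme_space_def space_pair_measure)
    ultimately show ?thesis
      using ab unfolding T y_def[symmetric] by (auto simp: abs_if split: if_splits)
  qed
  have "emeasure (scheme_space sph n L M P P' Ka) ?E \<le> ?F Kt + ennreal (p0 sph n Ka P P')"
  proof (cases "Kest < Kt")
    case True
    have "emeasure (scheme_space sph n L M P P' Ka) ?E \<le>
        (\<integral>\<^sup>+(cb,w). ennreal (p1_integrand n L M Ka P' ?Kth cb w) \<partial>(codebook_measure sph n M P P' \<Otimes>\<^sub>M msg_measure Ka M))
          + ennreal (p0 sph n Ka P P')"
    proof (rule slice_bound_imp_union_bound)
      fix cb w assume w: "\<And>k. k < Ka \<Longrightarrow> w k < M" and pw: "\<And>k. k < Ka \<Longrightarrow> vsqnorm n (cb (w k)) \<le> real n * P"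
      show "emeasure ?HZ {p. (cb,w,p) \<in> ?E} \<le> ennreal (p1_integrand n L M Ka P' ?Kth cb w)"
        unfolding HZ.emeasure_eq_measure
        by (intro ennreal_leI measure_le_p1_integrand w) (use slice[of _ _ cb w, OF _ pw] True in auto)
    qed (use assms in auto)
    then show ?thesis using True by (simp add: p1_def)
  next
    case False
    then have less: "Kt < Kest" using Kt(2) by simp
    have "emeasure (scheme_space sph n L M P P' Ka) ?E \<le>
        (\<integral>\<^sup>+(cb,w). ennreal (p2_integrand n L M Ka P' ?Kth cb w) \<partial>(codebook_measure sph n M P P' \<Otimes>\<^sub>M msg_measure Ka M))
          + ennreal (p0 sph n Ka P P')"
    proof (rule slice_bound_imp_union_bound)
      fix cb w assume w: "\<And>k. k < Ka \<Longrightarrow> w k < M" and pw: "\<And>k. k < Ka \<Longrightarrow> vsqnorm n (cb (w k)) \<le> real n * P"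
      show "emeasure ?HZ {p. (cb,w,p) \<in> ?E} \<le> ennreal (p2_integrand n L M Ka P' ?Kth cb w)"
        unfolding HZ.emeasure_eq_measure
        by (intro ennreal_leI measure_le_p2_integrand assms(1) w) (use slice[of _ _ cb w, OF _ pw] less in auto)
    qed (use assms in auto)
    then show ?thesis using less by (simp add: p2_def)
  qed
  then show ?thesis using p_new by simp
qed

end
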